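(* Let $V$ be a projective variety over a field $k$ and let $(g,S,\mathcal A,\beta)$ be admissible weight data. Let $S'\sqcup S''=S$ be a partition of the set of labels such that $\mathcal A(S''):=\sum_{i\in S''}\mathcal A(i)\le1$. Then there is a natural map $$\overline{\mathcal M}_{g,\mathcal A|_{S'}\cup\{*\mapsto\mathcal A(S'')\}}(V,\beta)\to\overline{\mathcal M}_{g,\mathcal A}(V,\beta),$$ given by setting $s_i=s_*$ for all $i\in S''$ (and leaving the curve, the map to $V$ and the sections $s_i$, $i\in S'$, unchanged).
   Context: Classes: $H_2^+(V)$ denotes the semigroup of classes of effective $1$-cycles on $V$, considered modulo numerical equivalence, i.e. as homomorphisms $\operatorname{Pic}(V)\to\mathbb Z$, $L\mapsto \beta\cdot L$. Data: $g\ge 0$ is an integer, $S$ a finite set, $\mathcal A\colon S\to\mathbb Q\cap[0,1]$ a weight function, $\beta\in H_2^+(V)$. The notation $\mathcal A|_{S'}\cup\{*\mapsto a\}$ is the weight function on $S'\sqcup\{*\}$ extending $\mathcal A|_{S'}$ by the value $a$ at $*$. A nodal curve of genus $g$ over a $k$-scheme $T$ is a proper flat morphism $\pi\colon C\to T$ of finite type whose geometric fibers are connected curves of genus $g$ with only nodes as singularities. A prestable map of type $(g,\mathcal A,\beta)$ over $T$ is a tuple $(C,\pi,s,f)$ where $\pi\colon C\to T$ is a nodal curve of genus $g$, $s=(s_i)_{i\in S}$ is a tuple of sections of $\pi$, and $f\colon C\to V$ is a morphism with $f_*([C])=\beta$ (on geometric fibers), such that (1) the image of any $s_i$ with $\mathcal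 A(i)>0$ lies in the smooth locus of $C/T$; (2) for any $I\subset S$ with $\bigcap_{i\in I}s_i(T)\neq\emptyset$ one has $\sum_{i\in I}\mathcal A(i)\le 1$. It is stable of type $(g,\mathcal A,\beta)$ if $K_\pi+\sum_{i\in S}\mathcal A(i)s_i+3f^*(M)$ is $\pi$-relatively ample for some ample divisor $M$ on $V$. $\overline{\mathcal M}_{g,\mathcal A}(V,\beta)$ is the stack over $k$ of stable maps of type $(g,\mathcal A,\beta)$ and their isomorphisms. The data $(g,S,\mathcal A,\beta)$ are admissible if ($\beta\neq0$ or $2g-2+\sum_{i}\mathcal A(i)>0$) and $\beta$ is bounded by the characteristic ($\operatorname{char}k=0$ or $\beta\cdot L<\operatorname{char} k$ for some very ample $L$ on $V$). *)

theory Defs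
  imports
    "HOL-Analysis.Abstract_Topology"
    "HOL-Library.Multiset"
    "HOL-Algebra.Algebra"
begin

text \<open>\<open>X\<close> is used as a variable below.\<close>

no_notation Polynomials.var (\<open>X\<index>\<close>)

text \<open>
  The libraries contain no scheme theory, so schemes, morphisms, fibre products, properness,
  flatness, line bundles, \<open>H\<^sup>1\<close>, relative dualizing sheaves and the category of stable maps are built
  here from locally ringed spaces over HOL-Algebra rings.

  Size convention.  A space has a type of points and a type of sections, and these types play the
  part of a universe.  Whenever a definition quantifies over auxiliary schemes, rings or modules
  (test objects of a universal property, geometric points, fibre products, \dots) their types are
  chosen large enough to contain, up to isomorphism, all objects that are relevant; the reason is
  given at each such place.
\<close>


section \<open>Rings and modules\<close>

text \<open>The class of \<open>a / s\<close> in the localization of \<open>R\<close> at the multiplicative set \<open>S\<close>.\<close>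

definition lfrac :: "'a ring \<Rightarrow> 'a set \<Rightarrow> 'a \<Rightarrow> 'a \<Rightarrow> ('a \<times> 'a) set" where
  "lfrac R S a s = {(b, t). b \<in> carrier R \<and> t \<in> S \<and>
     (\<exists>u\<in>S. u \<otimes>\<^bsub>R\<^esub> (t \<otimes>\<^bsub>R\<^esub> a) = u \<otimes>\<^bsub>R\<^esub> (s \<otimes>\<^bsub>R\<^esub> b))}"

text \<open>
  Operations on classes are written as unions over all representatives; since they do not depend
  on the representatives, the union is one class.  The same device is used for stalks and \<open>H\<^sup>1\<close>.
\<close>

definition localization :: "'a ring \<Rightarrow> 'a set \<Rightarrow> ('a \<times> 'a) set ring" where
  "localization R S =
    \<lparr> carrier = {lfrac R S a s | a s. a \<in> carrier R \<and> s \<in> S},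
      monoid.mult = (\<lambda>x y. \<Union>{lfrac R S (a \<otimes>\<^bsub>R\<^esub> b) (s \<otimes>\<^bsub>R\<^esub> t) | a s b t. (a, s) \<in> x \<and> (b, t) \<in> y}),
      monoid.one = lfrac R S \<one>\<^bsub>R\<^esub> \<one>\<^bsub>R\<^esub>,
      ring.zero = lfrac R S \<zero>\<^bsub>R\<^esub> \<one>\<^bsub>R\<^esub>,
      ring.add = (\<lambda>x y. \<Union>{lfrac R S ((a \<otimes>\<^bsub>R\<^esub> t) \<oplus>\<^bsub>R\<^esub> (b \<otimes>\<^bsub>R\<^esub> s)) (s \<otimes>\<^bsub>R\<^esub> t) | a s b t.
                (a, s) \<in> x \<and> (b, t) \<in> y}) \<rparr>"

definition local_ring :: "'a ring \<Rightarrow> bool" where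
  "local_ring R \<longleftrightarrow> cring R \<and> (\<exists>!I. maximalideal I R)"

definition max_ideal :: "'a ring \<Rightarrow> 'a set" where
  "max_ideal R = (THE I. maximalideal I R)"

definition ring_char :: "'a ring \<Rightarrow> nat" where
  "ring_char R = (if \<exists>n::nat. n > 0 \<and> [n] \<cdot>\<^bsub>R\<^esub> \<one>\<^bsub>R\<^esub> = \<zero>\<^bsub>R\<^esub>
     then (LEAST n::nat. n > 0 \<and> [n] \<cdot>\<^bsub>R\<^esub> \<one>\<^bsub>R\<^esub> = \<zero>\<^bsub>R\<^esub>) else 0)"

text \<open>
  Power series and polynomials in \<open>x\<^sub>0, \<dots>, x\<^sub>n\<^sub>-\<^sub>1\<close>: a monomial is the multiset of its variables.
\<close>

definition power_series_ring :: "'a ring \<Rightarrow> nat \<Rightarrow> (nat multiset \<Rightarrow> 'a) ring" where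
  "power_series_ring R n =
    \<lparr> carrier = {p. (\<forall>M. p M \<in> carrier R) \<and> (\<forall>M. \<not> set_mset M \<subseteq> {..<n} \<longrightarrow> p M = \<zero>\<^bsub>R\<^esub>)},
      monoid.mult = (\<lambda>p q M. finsum R (\<lambda>N. p N \<otimes>\<^bsub>R\<^esub> q (M - N)) {N. N \<subseteq># M}),
      monoid.one = (\<lambda>M. if M = {#} then \<one>\<^bsub>R\<^esub> else \<zero>\<^bsub>R\<^esub>),
      ring.zero = (\<lambda>M. \<zero>\<^bsub>R\<^esub>),
      ring.add = (\<lambda>p q M. p M \<oplus>\<^bsub>R\<^esub> q M) \<rparr>"

definition mpoly_ring :: "'a ring \<Rightarrow> nat \<Rightarrow> (nat multiset \<Rightarrow> 'a) ring" where
  "mpoly_ring R n = (power_series_ring R n)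
     \<lparr> carrier := {p \<in> carrier (power_series_ring R n). finite {M. p M \<noteq> \<zero>\<^bsub>R\<^esub>}} \<rparr>"

definition mvar :: "'a ring \<Rightarrow> nat \<Rightarrow> nat multiset \<Rightarrow> 'a" where
  "mvar R i = (\<lambda>M. if M = {#i#} then \<one>\<^bsub>R\<^esub> else \<zero>\<^bsub>R\<^esub>)"

definition mconst :: "'a ring \<Rightarrow> 'a \<Rightarrow> nat multiset \<Rightarrow> 'a" where
  "mconst R a = (\<lambda>M. if M = {#} then a else \<zero>\<^bsub>R\<^esub>)"

definition meval :: "'a ring \<Rightarrow> 'b ring \<Rightarrow> ('a \<Rightarrow> 'b) \<Rightarrow> (nat \<Rightarrow> 'b) \<Rightarrow> (nat multiset \<Rightarrow> 'a) \<Rightarrow> 'b" where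
  "meval A B \<phi> y p =
     finsum B (\<lambda>M. \<phi> (p M) \<otimes>\<^bsub>B\<^esub> finprod B (\<lambda>i. y i [^]\<^bsub>B\<^esub> count M i) (set_mset M)) {M. p M \<noteq> \<zero>\<^bsub>A\<^esub>}"

definition finite_type_hom :: "'a ring \<Rightarrow> 'b ring \<Rightarrow> ('a \<Rightarrow> 'b) \<Rightarrow> bool" where
  "finite_type_hom A B \<phi> \<longleftrightarrow>
     (\<exists>F \<subseteq> carrier B. finite F \<and> generate_ring B (\<phi> ` carrier A \<union> F) = carrier B)"

definition finite_presentation_hom :: "'a ring \<Rightarrow> 'b ring \<Rightarrow> ('a \<Rightarrow> 'b) \<Rightarrow> bool" where
  "finite_presentation_hom A B \<phi> \<longleftrightarrow>
     (\<exists>n y E. y \<in> {..<n} \<rightarrow> carrier B \<and>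
        meval A B \<phi> y ` carrier (mpoly_ring A n) = carrier B \<and>
        finite E \<and> E \<subseteq> carrier (mpoly_ring A n) \<and>
        {p \<in> carrier (mpoly_ring A n). meval A B \<phi> y p = \<zero>\<^bsub>B\<^esub>} = Idl\<^bsub>mpoly_ring A n\<^esub> E)"

text \<open>
  Equality in \<open>M \<otimes>\<^sub>A N\<close>: a list of pairs stands for the sum of the corresponding elementary tensors.
\<close>

inductive tensor_eq :: "'a ring \<Rightarrow> ('a, 'm) module \<Rightarrow> ('a, 'n) module \<Rightarrow>
    ('m \<times> 'n) list \<Rightarrow> ('m \<times> 'n) list \<Rightarrow> bool" for A M N where
  refl: "tensor_eq A M N u u"
| sym: "tensor_eq A M N u v \<Longrightarrow> tensor_eq A M N v u"
| trans: "tensor_eq A M N u v \<Longrightarrow> tensor_eq A M N v w \<Longrightarrow> tensor_eq A M N u w"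
| append: "tensor_eq A M N u v \<Longrightarrow> tensor_eq A M N u' v' \<Longrightarrow> tensor_eq A M N (u @ u') (v @ v')"
| commute: "tensor_eq A M N (u @ v) (v @ u)"
| zero: "y \<in> carrier N \<Longrightarrow> tensor_eq A M N [(\<zero>\<^bsub>M\<^esub>, y)] []"
| add_left: "x \<in> carrier M \<Longrightarrow> x' \<in> carrier M \<Longrightarrow> y \<in> carrier N \<Longrightarrow>
    tensor_eq A M N [(x \<oplus>\<^bsub>M\<^esub> x', y)] [(x, y), (x', y)]"
| add_right: "x \<in> carrier M \<Longrightarrow> y \<in> carrier N \<Longrightarrow> y' \<in> carrier N \<Longrightarrow>
    tensor_eq A M N [(x, y \<oplus>\<^bsub>N\<^esub> y')] [(x, y), (x, y')]"
| scalar: "a \<in> carrier A \<Longrightarrow> x \<in> carrier M \<Longrightarrow> y \<in> carrier N \<Longrightarrow>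
    tensor_eq A M N [(a \<odot>\<^bsub>M\<^esub> x, y)] [(x, a \<odot>\<^bsub>N\<^esub> y)]"

text \<open>
  \<open>N\<close> is flat if \<open>M' \<otimes> N \<rightarrow> M \<otimes> N\<close> is injective for all submodules \<open>M'\<close> of \<open>M\<close>.  The modules \<open>M\<close>
  on the type \<open>'a \<times> nat\<close> include a copy of \<open>A\<close>, and already its ideals test flatness.
\<close>

definition flat_module :: "'a ring \<Rightarrow> ('a, 'n) module \<Rightarrow> bool" where
  "flat_module A N \<longleftrightarrow> (\<forall>(M :: ('a, 'a \<times> nat) module) M'.
     Module.module A M \<and> submodule M' A M \<longrightarrow>
     (\<forall>u \<in> lists (M' \<times> carrier N).
        tensor_eq A M N u [] \<longrightarrow> tensor_eq A (M\<lparr>carrier := M'\<rparr>) N u []))"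

definition algebra_module :: "'b ring \<Rightarrow> ('a \<Rightarrow> 'b) \<Rightarrow> ('a, 'b) module" where
  "algebra_module B \<phi> = \<lparr> carrier = carrier B, monoid.mult = monoid.mult B, monoid.one = monoid.one B,
     ring.zero = ring.zero B, ring.add = ring.add B, smult = (\<lambda>a b. \<phi> a \<otimes>\<^bsub>B\<^esub> b) \<rparr>"

definition restrict_scalars :: "('c \<Rightarrow> 'a) \<Rightarrow> ('a, 'm) module \<Rightarrow> ('c, 'm) module" where
  "restrict_scalars \<phi> M = \<lparr> carrier = carrier M, monoid.mult = monoid.mult M, monoid.one = monoid.one M,
     ring.zero = ring.zero M, ring.add = ring.add M, smult = (\<lambda>a m. \<phi> a \<odot>\<^bsub>M\<^esub> m) \<rparr>"

definition vs_dim :: "'k ring \<Rightarrow> ('k, 'm) module \<Rightarrow> nat \<Rightarrow> bool" where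
  "vs_dim K M n \<longleftrightarrow> (\<exists>b \<in> {..<n} \<rightarrow> carrier M. \<forall>m \<in> carrier M.
     \<exists>!a. a \<in> {..<n} \<rightarrow>\<^sub>E carrier K \<and> m = finsum M (\<lambda>i. a i \<odot>\<^bsub>M\<^esub> b i) {..<n})"

primrec ideal_power :: "'a ring \<Rightarrow> 'a set \<Rightarrow> nat \<Rightarrow> 'a set" where
  "ideal_power R I 0 = carrier R"
| "ideal_power R I (Suc n) = ideal_prod R I (ideal_power R I n)"

text \<open>
  The \<open>I\<close>-adic completion: sequences of cosets \<open>c n \<in> R / I\<^sup>n\<close>; two consecutive ones are compatible iff
  \<open>c (n + 1) \<subseteq> c n\<close>.
\<close>

definition completion :: "'a ring \<Rightarrow> 'a set \<Rightarrow> (nat \<Rightarrow> 'a set) ring" where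
  "completion R I =
    \<lparr> carrier = {c. \<forall>n. c n \<in> carrier (R Quot ideal_power R I n) \<and> c (Suc n) \<subseteq> c n},
      monoid.mult = (\<lambda>c d n. c n \<otimes>\<^bsub>R Quot ideal_power R I n\<^esub> d n),
      monoid.one = (\<lambda>n. \<one>\<^bsub>R Quot ideal_power R I n\<^esub>),
      ring.zero = (\<lambda>n. \<zero>\<^bsub>R Quot ideal_power R I n\<^esub>),
      ring.add = (\<lambda>c d n. c n \<oplus>\<^bsub>R Quot ideal_power R I n\<^esub> d n) \<rparr>"


section \<open>Dimension of topological spaces\<close>

definition irreducible_closed :: "'p topology \<Rightarrow> 'p set \<Rightarrow> bool" where
  "irreducible_closed T Z \<longleftrightarrow> closedin T Z \<and> Z \<noteq> {} \<and>
     (\<forall>B C. closedin T B \<and> closedin T C \<and> Z \<subseteq> B \<union> C \<longrightarrow> Z \<subseteq> B \<or> Z \<subseteq> C)"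

definition closed_chain :: "'p topology \<Rightarrow> nat \<Rightarrow> (nat \<Rightarrow> 'p set) \<Rightarrow> bool" where
  "closed_chain T n Z \<longleftrightarrow>
     (\<forall>i\<le>n. irreducible_closed T (Z i)) \<and> (\<forall>i<n. Z i \<subset> Z (Suc i))"

definition top_dim :: "'p topology \<Rightarrow> nat \<Rightarrow> bool" where
  "top_dim T n \<longleftrightarrow> (\<exists>Z. closed_chain T n Z) \<and> \<not> (\<exists>Z. closed_chain T (Suc n) Z)"

definition irreducible_component :: "'p topology \<Rightarrow> 'p set \<Rightarrow> bool" where
  "irreducible_component T Z \<longleftrightarrow>
     irreducible_closed T Z \<and> (\<forall>Z'. irreducible_closed T Z' \<and> Z \<subseteq> Z' \<longrightarrow> Z' = Z)"


section \<open>Locally ringed spaces\<close>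

record ('p, 'r) rspace =
  rtop :: "'p topology"
  Sec :: "'p set \<Rightarrow> 'r ring"
  Res :: "'p set \<Rightarrow> 'p set \<Rightarrow> 'r \<Rightarrow> 'r"

abbreviation points :: "('p, 'r) rspace \<Rightarrow> 'p set" where
  "points X \<equiv> topspace (rtop X)"

abbreviation is_open :: "('p, 'r) rspace \<Rightarrow> 'p set \<Rightarrow> bool" where
  "is_open X U \<equiv> openin (rtop X) U"

definition ringed_space :: "('p, 'r) rspace \<Rightarrow> bool" where
  "ringed_space X \<longleftrightarrow>
     (\<forall>U. is_open X U \<longrightarrow> cring (Sec X U)) \<and>
     (\<forall>U W. is_open X U \<and> is_open X W \<and> W \<subseteq> U \<longrightarrow> Res X U W \<in> ring_hom (Sec X U) (Sec X W)) \<and>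
     (\<forall>U s. is_open X U \<and> s \<in> carrier (Sec X U) \<longrightarrow> Res X U U s = s) \<and>
     (\<forall>U W Z s. is_open X U \<and> is_open X W \<and> is_open X Z \<and> Z \<subseteq> W \<and> W \<subseteq> U \<and> s \<in> carrier (Sec X U) \<longrightarrow>
        Res X W Z (Res X U W s) = Res X U Z s) \<and>
     (\<forall>\<U> s. (\<forall>U\<in>\<U>. is_open X U \<and> s U \<in> carrier (Sec X U)) \<and>
        (\<forall>U\<in>\<U>. \<forall>W\<in>\<U>. Res X U (U \<inter> W) (s U) = Res X W (U \<inter> W) (s W)) \<longrightarrow>
        (\<exists>!t. t \<in> carrier (Sec X (\<Union>\<U>)) \<and> (\<forall>U\<in>\<U>. Res X (\<Union>\<U>) U t = s U)))"

definition germ :: "('p, 'r) rspace \<Rightarrow> 'p \<Rightarrow> 'p set \<Rightarrow> 'r \<Rightarrow> ('p set \<times> 'r) set" where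
  "germ X x U s = {(W, t). is_open X W \<and> x \<in> W \<and> t \<in> carrier (Sec X W) \<and>
     (\<exists>Z. is_open X Z \<and> x \<in> Z \<and> Z \<subseteq> U \<inter> W \<and> Res X U Z s = Res X W Z t)}"

definition stalk :: "('p, 'r) rspace \<Rightarrow> 'p \<Rightarrow> ('p set \<times> 'r) set ring" where
  "stalk X x =
    \<lparr> carrier = {germ X x U s | U s. is_open X U \<and> x \<in> U \<and> s \<in> carrier (Sec X U)},
      monoid.mult = (\<lambda>a b. \<Union>{germ X x (U \<inter> W) (Res X U (U \<inter> W) s \<otimes>\<^bsub>Sec X (U \<inter> W)\<^esub> Res X W (U \<inter> W) t)
                 | U s W t. (U, s) \<in> a \<and> (W, t) \<in> b}),
      monoid.one = germ X x (points X) \<one>\<^bsub>Sec X (points X)\<^esub>,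
      ring.zero = germ X x (points X) \<zero>\<^bsub>Sec X (points X)\<^esub>,
      ring.add = (\<lambda>a b. \<Union>{germ X x (U \<inter> W) (Res X U (U \<inter> W) s \<oplus>\<^bsub>Sec X (U \<inter> W)\<^esub> Res X W (U \<inter> W) t)
                 | U s W t. (U, s) \<in> a \<and> (W, t) \<in> b}) \<rparr>"

definition locally_ringed_space :: "('p, 'r) rspace \<Rightarrow> bool" where
  "locally_ringed_space X \<longleftrightarrow> ringed_space X \<and> (\<forall>x \<in> points X. local_ring (stalk X x))"

definition open_sub :: "('p, 'r) rspace \<Rightarrow> 'p set \<Rightarrow> ('p, 'r) rspace" where
  "open_sub X U = X\<lparr>rtop := subtopology (rtop X) U\<rparr>"

record ('p, 'a, 'q, 'b) rmor =
  src :: "('p, 'a) rspace"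
  tgt :: "('q, 'b) rspace"
  pmap :: "'p \<Rightarrow> 'q"
  cmap :: "'q set \<Rightarrow> 'b \<Rightarrow> 'a"

definition preim :: "('p, 'a, 'q, 'b) rmor \<Rightarrow> 'q set \<Rightarrow> 'p set" where
  "preim f U = {x \<in> points (src f). pmap f x \<in> U}"

definition stalk_map :: "('p, 'a, 'q, 'b) rmor \<Rightarrow> 'p \<Rightarrow> ('q set \<times> 'b) set \<Rightarrow> ('p set \<times> 'a) set" where
  "stalk_map f x a = \<Union>{germ (src f) x (preim f U) (cmap f U s) | U s. (U, s) \<in> a}"

text \<open>
  Morphisms of locally ringed spaces.  The two functions of the record are required to take the
  value \<open>undefined\<close> where they carry no information, so that equality of morphisms is equality
  of records.
\<close>

definition morphism :: "('p, 'a, 'q, 'b) rmor \<Rightarrow> bool" where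
  "morphism f \<longleftrightarrow>
     locally_ringed_space (src f) \<and> locally_ringed_space (tgt f) \<and>
     continuous_map (rtop (src f)) (rtop (tgt f)) (pmap f) \<and>
     pmap f \<in> extensional (points (src f)) \<and>
     (\<forall>U. is_open (tgt f) U \<longrightarrow>
        cmap f U \<in> ring_hom (Sec (tgt f) U) (Sec (src f) (preim f U)) \<and>
        cmap f U \<in> extensional (carrier (Sec (tgt f) U))) \<and>
     (\<forall>U. \<not> is_open (tgt f) U \<longrightarrow> cmap f U = (\<lambda>_. undefined)) \<and>
     (\<forall>U W. is_open (tgt f) U \<and> is_open (tgt f) W \<and> W \<subseteq> U \<longrightarrow>
        (\<forall>s \<in> carrier (Sec (tgt f) U).
           cmap f W (Res (tgt f) U W s) = Res (src f) (preim f U) (preim f W) (cmap f U s))) \<and>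
     (\<forall>x \<in> points (src f). \<forall>a \<in> carrier (stalk (tgt f) (pmap f x)).
        stalk_map f x a \<in> Units (stalk (src f) x) \<longrightarrow> a \<in> Units (stalk (tgt f) (pmap f x)))"

definition Mor :: "('p, 'a) rspace \<Rightarrow> ('q, 'b) rspace \<Rightarrow> ('p, 'a, 'q, 'b) rmor set" where
  "Mor X Y = {f. morphism f \<and> src f = X \<and> tgt f = Y}"

definition mid :: "('p, 'a) rspace \<Rightarrow> ('p, 'a, 'p, 'a) rmor" where
  "mid X = \<lparr> src = X, tgt = X, pmap = (\<lambda>x\<in>points X. x),
     cmap = (\<lambda>U. if is_open X U then (\<lambda>s\<in>carrier (Sec X U). s) else (\<lambda>_. undefined)) \<rparr>"

definition mcomp :: "('q, 'b, 'z, 'c) rmor \<Rightarrow> ('p, 'a, 'q, 'b) rmor \<Rightarrow> ('p, 'a, 'z, 'c) rmor"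
    (infixr "\<bullet>" 75) where
  "g \<bullet> f = \<lparr> src = src f, tgt = tgt g,
     pmap = (\<lambda>x\<in>points (src f). pmap g (pmap f x)),
     cmap = (\<lambda>U. if is_open (tgt g) U
       then (\<lambda>s\<in>carrier (Sec (tgt g) U). cmap f (preim g U) (cmap g U s))
       else (\<lambda>_. undefined)) \<rparr>"

definition isomorphic :: "('p, 'a) rspace \<Rightarrow> ('q, 'b) rspace \<Rightarrow> bool" where
  "isomorphic X Y \<longleftrightarrow> (\<exists>f \<in> Mor X Y. \<exists>g \<in> Mor Y X. g \<bullet> f = mid X \<and> f \<bullet> g = mid Y)"


section \<open>Affine schemes, projective space, schemes\<close>

text \<open>
  Common pattern of the structure sheaves of \<open>Spec\<close> and \<open>Proj\<close>: sections over \<open>U\<close> are the functions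
  \<open>P \<mapsto> s P\<close> with values in the localizations at \<open>S P\<close> that are locally given by one fraction \<open>a / f\<close>
  with \<open>(a, f)\<close> in the set \<open>E\<close> of admitted fractions.
\<close>

definition fraction_space ::
    "'a ring \<Rightarrow> 'p topology \<Rightarrow> ('p \<Rightarrow> 'a set) \<Rightarrow> ('a \<times> 'a) set \<Rightarrow> ('p, 'p \<Rightarrow> ('a \<times> 'a) set) rspace" where
  "fraction_space R T S E =
    \<lparr> rtop = T,
      Sec = (\<lambda>U.
        \<lparr> carrier = {s \<in> extensional U. \<forall>P\<in>U. \<exists>W. openin T W \<and> P \<in> W \<and> W \<subseteq> U \<and>
              (\<exists>(a, f) \<in> E. \<forall>Q\<in>W. f \<in> S Q \<and> s Q = lfrac R (S Q) a f)},
          monoid.mult = (\<lambda>s t. \<lambda>P\<in>U. s P \<otimes>\<^bsub>localization R (S P)\<^esub> t P),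
          monoid.one = (\<lambda>P\<in>U. \<one>\<^bsub>localization R (S P)\<^esub>),
          ring.zero = (\<lambda>P\<in>U. \<zero>\<^bsub>localization R (S P)\<^esub>),
          ring.add = (\<lambda>s t. \<lambda>P\<in>U. s P \<oplus>\<^bsub>localization R (S P)\<^esub> t P) \<rparr>),
      Res = (\<lambda>U W s. restrict s W) \<rparr>"

type_synonym 'a spec_pt = "'a set"
type_synonym 'a spec_sec = "'a set \<Rightarrow> ('a \<times> 'a) set"

definition Spec :: "'a ring \<Rightarrow> ('a spec_pt, 'a spec_sec) rspace" where
  "Spec R = fraction_space R
     (topology_generated_by {{P. primeideal P R \<and> f \<notin> P} | f. f \<in> carrier R})
     (\<lambda>P. carrier R - P)
     (carrier R \<times> carrier R)"

definition spec_const :: "'a ring \<Rightarrow> 'a \<Rightarrow> 'a spec_sec" where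
  "spec_const R a = (\<lambda>P\<in>points (Spec R). lfrac R (carrier R - P) a \<one>\<^bsub>R\<^esub>)"

definition affine_open :: "('p, 'r) rspace \<Rightarrow> 'p set \<Rightarrow> bool" where
  "affine_open X U \<longleftrightarrow> is_open X U \<and> isomorphic (open_sub X U) (Spec (Sec X U))"

definition scheme :: "('p, 'r) rspace \<Rightarrow> bool" where
  "scheme X \<longleftrightarrow> locally_ringed_space X \<and> (\<forall>x \<in> points X. \<exists>U. affine_open X U \<and> x \<in> U)"

definition integral_scheme :: "('p, 'r) rspace \<Rightarrow> bool" where
  "integral_scheme X \<longleftrightarrow> scheme X \<and> points X \<noteq> {} \<and>
     (\<forall>U. is_open X U \<and> U \<noteq> {} \<longrightarrow> domain (Sec X U))"

text \<open>Projective \<open>n\<close>-space over \<open>k\<close> as \<open>Proj k[x\<^sub>0, \<dots>, x\<^sub>n]\<close>.\<close>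

type_synonym 'k proj_pt = "(nat multiset \<Rightarrow> 'k) set"
type_synonym 'k proj_sec =
  "(nat multiset \<Rightarrow> 'k) set \<Rightarrow> ((nat multiset \<Rightarrow> 'k) \<times> (nat multiset \<Rightarrow> 'k)) set"

definition forms :: "'k ring \<Rightarrow> nat \<Rightarrow> nat \<Rightarrow> (nat multiset \<Rightarrow> 'k) set" where
  "forms k n d = {p \<in> carrier (mpoly_ring k (Suc n)). \<forall>M. p M \<noteq> \<zero>\<^bsub>k\<^esub> \<longrightarrow> size M = d}"

definition proj_points :: "'k ring \<Rightarrow> nat \<Rightarrow> 'k proj_pt set" where
  "proj_points k n = {P. primeideal P (mpoly_ring k (Suc n)) \<and>
     (\<forall>p\<in>P. \<forall>d. (\<lambda>M. if size M = d then p M else \<zero>\<^bsub>k\<^esub>) \<in> P) \<and> \<not> (\<forall>i\<le>n. mvar k i \<in> P)}"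

definition proj_mult_set :: "'k ring \<Rightarrow> nat \<Rightarrow> 'k proj_pt \<Rightarrow> (nat multiset \<Rightarrow> 'k) set" where
  "proj_mult_set k n P = (\<Union>d. forms k n d) - P"

definition Proj :: "'k ring \<Rightarrow> nat \<Rightarrow> ('k proj_pt, 'k proj_sec) rspace" where
  "Proj k n = fraction_space (mpoly_ring k (Suc n))
     (topology_generated_by {{P \<in> proj_points k n. f \<notin> P} | f d. f \<in> forms k n d})
     (proj_mult_set k n)
     (\<Union>d. forms k n d \<times> forms k n d)"

definition proj_structure :: "'k ring \<Rightarrow> nat \<Rightarrow> ('k proj_pt, 'k proj_sec, 'k spec_pt, 'k spec_sec) rmor" where
  "proj_structure k n =
    \<lparr> src = Proj k n, tgt = Spec k,
      pmap = (\<lambda>P\<in>points (Proj k n). {\<zero>\<^bsub>k\<^esub>}),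
      cmap = (\<lambda>U. if is_open (Spec k) U
        then (\<lambda>s\<in>carrier (Sec (Spec k) U). \<lambda>P\<in>{P \<in> points (Proj k n). {\<zero>\<^bsub>k\<^esub>} \<in> U}.
                \<Union>{lfrac (mpoly_ring k (Suc n)) (proj_mult_set k n P) (mconst k a) (mconst k b)
                   | a b. (a, b) \<in> s {\<zero>\<^bsub>k\<^esub>}})
        else (\<lambda>_. undefined)) \<rparr>"


section \<open>Fibre products and properties of morphisms\<close>

text \<open>
  \<open>p\<close> and \<open>q\<close> make their common source \<open>P\<close> the fibre product of \<open>f: X \<rightarrow> S\<close> and \<open>g: Y \<rightarrow> S\<close>.  It is
  enough to test the universal property on \<open>Spec B\<close>: morphisms from other schemes are glued.  The
  rings \<open>B\<close> on the type below include copies of the rings of affine opens of \<open>P\<close> and of \<open>A \<otimes> A'\<close> for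
  affine opens \<open>Spec A\<close> of \<open>X\<close> and \<open>Spec A'\<close> of \<open>Y\<close>, hence of an affine cover of the true product.
\<close>

definition is_pullback ::
    "('w, 'd, 'p, 'a) rmor \<Rightarrow> ('w, 'd, 'q, 'b) rmor \<Rightarrow> ('p, 'a, 'z, 'c) rmor \<Rightarrow> ('q, 'b, 'z, 'c) rmor \<Rightarrow> bool" where
  "is_pullback p q f g \<longleftrightarrow>
     scheme (src p) \<and> scheme (src f) \<and> scheme (src g) \<and> scheme (tgt f) \<and>
     p \<in> Mor (src p) (src f) \<and> q \<in> Mor (src p) (src g) \<and>
     f \<in> Mor (src f) (tgt f) \<and> g \<in> Mor (src g) (tgt f) \<and>
     f \<bullet> p = g \<bullet> q \<and>
     (\<forall>B :: ('d \<times> 'a \<times> 'b \<times> nat) ring. cring B \<longrightarrow>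
        (\<forall>u \<in> Mor (Spec B) (src f). \<forall>v \<in> Mor (Spec B) (src g). f \<bullet> u = g \<bullet> v \<longrightarrow>
           (\<exists>!w. w \<in> Mor (Spec B) (src p) \<and> p \<bullet> w = u \<and> q \<bullet> w = v)))"

text \<open>
  Types that can hold a fibre product of spaces of types \<open>('p, 'a)\<close> and \<open>('q, 'b)\<close>: a point is
  determined by its two projections and a prime of a tensor product of local charts, a section by
  its germs, and each stalk is a localization of such a tensor product.
\<close>

type_synonym ('p, 'a, 'q, 'b) fprod_pt = "'p \<times> 'q \<times> ('a \<times> 'b \<times> nat) set"
type_synonym ('p, 'a, 'q, 'b) fprod_sec = "('p, 'a, 'q, 'b) fprod_pt \<Rightarrow> 'a \<times> 'b \<times> nat"

definition closed_immersion :: "('p, 'a, 'q, 'b) rmor \<Rightarrow> bool" where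
  "closed_immersion i \<longleftrightarrow> morphism i \<and> scheme (src i) \<and> scheme (tgt i) \<and>
     embedding_map (rtop (src i)) (rtop (tgt i)) (pmap i) \<and>
     closedin (rtop (tgt i)) (pmap i ` points (src i)) \<and>
     (\<forall>x \<in> points (src i).
        stalk_map i x ` carrier (stalk (tgt i) (pmap i x)) = carrier (stalk (src i) x))"

definition separated :: "('p, 'a, 'q, 'b) rmor \<Rightarrow> bool" where
  "separated f \<longleftrightarrow>
     (\<exists>(p :: (('p, 'a, 'p, 'a) fprod_pt, ('p, 'a, 'p, 'a) fprod_sec, 'p, 'a) rmor) q \<delta>.
        is_pullback p q f f \<and> \<delta> \<in> Mor (src f) (src p) \<and>
        p \<bullet> \<delta> = mid (src f) \<and> q \<bullet> \<delta> = mid (src f) \<and> closed_immersion \<delta>)"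

definition chart_map :: "('p, 'a, 'q, 'b) rmor \<Rightarrow> 'p set \<Rightarrow> 'q set \<Rightarrow> 'b \<Rightarrow> 'a" where
  "chart_map f U W s = Res (src f) (preim f W) U (cmap f W s)"

definition of_finite_type :: "('p, 'a, 'q, 'b) rmor \<Rightarrow> bool" where
  "of_finite_type f \<longleftrightarrow> (\<forall>y \<in> points (tgt f). \<exists>W. affine_open (tgt f) W \<and> y \<in> W \<and>
     (\<exists>\<U>. finite \<U> \<and> \<Union>\<U> = preim f W \<and>
        (\<forall>U\<in>\<U>. affine_open (src f) U \<and>
           finite_type_hom (Sec (tgt f) W) (Sec (src f) U) (chart_map f U W))))"

text \<open>
  For universal closedness it is enough to consider affine base changes \<open>Spec B \<rightarrow> Y\<close>, and among
  them the affine spaces over affine opens of \<open>Y\<close>; the type of \<open>B\<close> is large enough for these.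
\<close>

definition universally_closed :: "('p, 'a, 'q, 'b) rmor \<Rightarrow> bool" where
  "universally_closed f \<longleftrightarrow>
     (\<forall>(B :: ('b \<times> nat) ring) t
       (p :: (('p, 'a, ('b \<times> nat) spec_pt, ('b \<times> nat) spec_sec) fprod_pt,
              ('p, 'a, ('b \<times> nat) spec_pt, ('b \<times> nat) spec_sec) fprod_sec, 'p, 'a) rmor) q.
        cring B \<and> t \<in> Mor (Spec B) (tgt f) \<and> is_pullback p q f t \<longrightarrow>
        closed_map (rtop (src q)) (rtop (tgt q)) (pmap q))"

definition proper :: "('p, 'a, 'q, 'b) rmor \<Rightarrow> bool" where
  "proper f \<longleftrightarrow> separated f \<and> of_finite_type f \<and> universally_closed f"

definition flat_at :: "('p, 'a, 'q, 'b) rmor \<Rightarrow> 'p \<Rightarrow> bool" where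
  "flat_at f x \<longleftrightarrow>
     flat_module (stalk (tgt f) (pmap f x)) (algebra_module (stalk (src f) x) (stalk_map f x))"

definition finitely_presented_at :: "('p, 'a, 'q, 'b) rmor \<Rightarrow> 'p \<Rightarrow> bool" where
  "finitely_presented_at f x \<longleftrightarrow> (\<exists>U W. affine_open (src f) U \<and> affine_open (tgt f) W \<and> x \<in> U \<and>
     U \<subseteq> preim f W \<and> finite_presentation_hom (Sec (tgt f) W) (Sec (src f) U) (chart_map f U W))"

text \<open>
  \<open>p: F \<rightarrow> X\<close>, \<open>q: F \<rightarrow> Spec K\<close> is a geometric fibre of \<open>f: X \<rightarrow> Y\<close>.  Fields \<open>K\<close> on the type
  \<open>'b \<times> nat\<close> include an algebraic closure of every residue field of \<open>Y\<close>, and the properties of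
  geometric fibres used below do not depend on the choice of the algebraically closed field.
\<close>

definition geometric_fibre ::
    "('p, 'a, 'q, 'b) rmor \<Rightarrow> ('b \<times> nat) ring \<Rightarrow>
     (('p, 'a, ('b \<times> nat) spec_pt, ('b \<times> nat) spec_sec) fprod_pt,
      ('p, 'a, ('b \<times> nat) spec_pt, ('b \<times> nat) spec_sec) fprod_sec, 'p, 'a) rmor \<Rightarrow>
     (('p, 'a, ('b \<times> nat) spec_pt, ('b \<times> nat) spec_sec) fprod_pt,
      ('p, 'a, ('b \<times> nat) spec_pt, ('b \<times> nat) spec_sec) fprod_sec,
      ('b \<times> nat) spec_pt, ('b \<times> nat) spec_sec) rmor \<Rightarrow> bool" where
  "geometric_fibre f K p q \<longleftrightarrow> algebraically_closed K \<and>
     (\<exists>t. t \<in> Mor (Spec K) (tgt f) \<and> is_pullback p q f t)"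

definition regular_local_ring :: "'a ring \<Rightarrow> bool" where
  "regular_local_ring R \<longleftrightarrow> local_ring R \<and> noetherian_ring R \<and>
     (\<exists>n F. top_dim (rtop (Spec R)) n \<and> finite F \<and> card F \<le> n \<and> F \<subseteq> carrier R \<and>
        Idl\<^bsub>R\<^esub> F = max_ideal R)"

definition smooth_at :: "('p, 'a, 'q, 'b) rmor \<Rightarrow> 'p \<Rightarrow> bool" where
  "smooth_at f x \<longleftrightarrow> flat_at f x \<and> finitely_presented_at f x \<and>
     (\<forall>K p q. geometric_fibre f K p q \<longrightarrow>
        (\<forall>y \<in> points (src p). pmap p y = x \<longrightarrow> regular_local_ring (stalk (src p) y)))"

definition node :: "'k ring \<Rightarrow> ('p, 'r) rspace \<Rightarrow> 'p \<Rightarrow> bool" where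
  "node K X x \<longleftrightarrow>
     completion (stalk X x) (max_ideal (stalk X x)) \<simeq>
     (power_series_ring K 2 Quot
        (Idl\<^bsub>power_series_ring K 2\<^esub> {mvar K 0 \<otimes>\<^bsub>power_series_ring K 2\<^esub> mvar K 1}))"


section \<open>Sheaves of modules and first cohomology\<close>

record ('p, 'r, 'm) msheaf =
  msec :: "'p set \<Rightarrow> ('r, 'm) module"
  mres :: "'p set \<Rightarrow> 'p set \<Rightarrow> 'm \<Rightarrow> 'm"

definition module_sheaf :: "('p, 'r) rspace \<Rightarrow> ('p, 'r, 'm) msheaf \<Rightarrow> bool" where
  "module_sheaf X F \<longleftrightarrow>
     (\<forall>U. is_open X U \<longrightarrow> Module.module (Sec X U) (msec F U)) \<and>
     (\<forall>U W. is_open X U \<and> is_open X W \<and> W \<subseteq> U \<longrightarrow>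
        (\<forall>m \<in> carrier (msec F U). mres F U W m \<in> carrier (msec F W) \<and>
           (\<forall>m' \<in> carrier (msec F U).
              mres F U W (m \<oplus>\<^bsub>msec F U\<^esub> m') = mres F U W m \<oplus>\<^bsub>msec F W\<^esub> mres F U W m') \<and>
           (\<forall>a \<in> carrier (Sec X U).
              mres F U W (a \<odot>\<^bsub>msec F U\<^esub> m) = Res X U W a \<odot>\<^bsub>msec F W\<^esub> mres F U W m))) \<and>
     (\<forall>U m. is_open X U \<and> m \<in> carrier (msec F U) \<longrightarrow> mres F U U m = m) \<and>
     (\<forall>U W Z m. is_open X U \<and> is_open X W \<and> is_open X Z \<and> Z \<subseteq> W \<and> W \<subseteq> U \<and> m \<in> carrier (msec F U) \<longrightarrow>
        mres F W Z (mres F U W m) = mres F U Z m) \<and>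
     (\<forall>\<U> s. (\<forall>U\<in>\<U>. is_open X U \<and> s U \<in> carrier (msec F U)) \<and>
        (\<forall>U\<in>\<U>. \<forall>W\<in>\<U>. mres F U (U \<inter> W) (s U) = mres F W (U \<inter> W) (s W)) \<longrightarrow>
        (\<exists>!t. t \<in> carrier (msec F (\<Union>\<U>)) \<and> (\<forall>U\<in>\<U>. mres F (\<Union>\<U>) U t = s U)))"

text \<open>The open set \<open>D(a)\<close>, for a section \<open>a\<close> over \<open>U\<close>.\<close>

definition basic_open :: "('p, 'r) rspace \<Rightarrow> 'p set \<Rightarrow> 'r \<Rightarrow> 'p set" where
  "basic_open X U a = {x \<in> U. germ X x U a \<in> Units (stalk X x)}"

text \<open>
  \<open>F\<close> is quasi-coherent if on each affine open \<open>U\<close> it is the sheaf associated with the module \<open>F(U)\<close>,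
  that is, the map from \<open>F(U)\<^sub>a\<close> to \<open>F(D(a))\<close> is bijective for all \<open>a\<close>: the two clauses express
  injectivity and surjectivity.
\<close>

definition quasi_coherent :: "('p, 'r) rspace \<Rightarrow> ('p, 'r, 'm) msheaf \<Rightarrow> bool" where
  "quasi_coherent X F \<longleftrightarrow> module_sheaf X F \<and>
     (\<forall>U. affine_open X U \<longrightarrow> (\<forall>a \<in> carrier (Sec X U). let D = basic_open X U a in
        (\<forall>m \<in> carrier (msec F U). mres F U D m = \<zero>\<^bsub>msec F D\<^esub> \<longrightarrow>
           (\<exists>n::nat. (a [^]\<^bsub>Sec X U\<^esub> n) \<odot>\<^bsub>msec F U\<^esub> m = \<zero>\<^bsub>msec F U\<^esub>)) \<and>
        (\<forall>m \<in> carrier (msec F D). \<exists>n::nat. \<exists>m' \<in> carrier (msec F U).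
           mres F U D m' = Res X U D (a [^]\<^bsub>Sec X U\<^esub> n) \<odot>\<^bsub>msec F D\<^esub> m)))"

definition structure_sheaf :: "('p, 'r) rspace \<Rightarrow> ('p, 'r, 'r) msheaf" where
  "structure_sheaf X = \<lparr> msec = (\<lambda>U. algebra_module (Sec X U) (\<lambda>a. a)), mres = Res X \<rparr>"

definition msheaf_hom ::
    "('p, 'r) rspace \<Rightarrow> ('p, 'r, 'm) msheaf \<Rightarrow> ('p, 'r, 'n) msheaf \<Rightarrow> ('p set \<Rightarrow> 'm \<Rightarrow> 'n) set" where
  "msheaf_hom X F G = {\<phi>.
     (\<forall>U. is_open X U \<longrightarrow> \<phi> U \<in> carrier (msec F U) \<rightarrow>\<^sub>E carrier (msec G U) \<and>
        (\<forall>m \<in> carrier (msec F U).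
           (\<forall>m' \<in> carrier (msec F U). \<phi> U (m \<oplus>\<^bsub>msec F U\<^esub> m') = \<phi> U m \<oplus>\<^bsub>msec G U\<^esub> \<phi> U m') \<and>
           (\<forall>a \<in> carrier (Sec X U). \<phi> U (a \<odot>\<^bsub>msec F U\<^esub> m) = a \<odot>\<^bsub>msec G U\<^esub> \<phi> U m) \<and>
           (\<forall>W. is_open X W \<and> W \<subseteq> U \<longrightarrow> \<phi> W (mres F U W m) = mres G U W (\<phi> U m)))) \<and>
     (\<forall>U. \<not> is_open X U \<longrightarrow> \<phi> U = (\<lambda>_. undefined))}"

text \<open>
  \<open>H\<^sup>1(W, F)\<close> is the colimit of the Cech groups over all open covers of \<open>W\<close> (in degree one this is
  sheaf cohomology on any space).  The covers indexed by the points of \<open>W\<close>, with \<open>x \<in> U x\<close>, are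
  cofinal, so only these are used.  In \<open>(U, c)\<close>, the section \<open>c x y\<close> is defined on \<open>U x \<inter> U y\<close>.
\<close>

type_synonym ('p, 'm) cocycle = "('p \<Rightarrow> 'p set) \<times> ('p \<Rightarrow> 'p \<Rightarrow> 'm)"

definition cocycles :: "('p, 'r) rspace \<Rightarrow> ('p, 'r, 'm) msheaf \<Rightarrow> 'p set \<Rightarrow> ('p, 'm) cocycle set" where
  "cocycles X F W = {(U, c).
     (\<forall>x\<in>W. is_open X (U x) \<and> x \<in> U x \<and> U x \<subseteq> W) \<and>
     (\<forall>x\<in>W. \<forall>y\<in>W. c x y \<in> carrier (msec F (U x \<inter> U y))) \<and>
     (\<forall>x\<in>W. \<forall>y\<in>W. \<forall>z\<in>W. let D = U x \<inter> U y \<inter> U z in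
        mres F (U x \<inter> U z) D (c x z) =
          mres F (U x \<inter> U y) D (c x y) \<oplus>\<^bsub>msec F D\<^esub> mres F (U y \<inter> U z) D (c y z))}"

fun cohomologous ::
    "('p, 'r) rspace \<Rightarrow> ('p, 'r, 'm) msheaf \<Rightarrow> 'p set \<Rightarrow> ('p, 'm) cocycle \<Rightarrow> ('p, 'm) cocycle \<Rightarrow> bool" where
  "cohomologous X F W (U, c) (U', c') \<longleftrightarrow> (\<exists>N b.
     (\<forall>x\<in>W. is_open X (N x) \<and> x \<in> N x \<and> N x \<subseteq> U x \<inter> U' x \<and> b x \<in> carrier (msec F (N x))) \<and>
     (\<forall>x\<in>W. \<forall>y\<in>W. let D = N x \<inter> N y in
        mres F (U x \<inter> U y) D (c x y) \<oplus>\<^bsub>msec F D\<^esub> mres F (N x) D (b x) =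
        mres F (U' x \<inter> U' y) D (c' x y) \<oplus>\<^bsub>msec F D\<^esub> mres F (N y) D (b y)))"

definition coh_class ::
    "('p, 'r) rspace \<Rightarrow> ('p, 'r, 'm) msheaf \<Rightarrow> 'p set \<Rightarrow> ('p, 'm) cocycle \<Rightarrow> ('p, 'm) cocycle set" where
  "coh_class X F W z = {z' \<in> cocycles X F W. cohomologous X F W z z'}"

text \<open>As a module over the ring of sections over \<open>W\<close>; the fields \<open>mult\<close> and \<open>one\<close> have no meaning.\<close>

definition H1 :: "('p, 'r) rspace \<Rightarrow> ('p, 'r, 'm) msheaf \<Rightarrow> 'p set \<Rightarrow> ('r, ('p, 'm) cocycle set) module" where
  "H1 X F W =
    \<lparr> carrier = coh_class X F W ` cocycles X F W,
      monoid.mult = undefined, monoid.one = undefined,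
      ring.zero = coh_class X F W (\<lambda>_. W, \<lambda>_ _. \<zero>\<^bsub>msec F W\<^esub>),
      ring.add = (\<lambda>\<xi> \<eta>. \<Union>{coh_class X F W (\<lambda>x. U x \<inter> U' x, \<lambda>x y. let D = (U x \<inter> U' x) \<inter> (U y \<inter> U' y) in
                mres F (U x \<inter> U y) D (c x y) \<oplus>\<^bsub>msec F D\<^esub> mres F (U' x \<inter> U' y) D (c' x y))
              | U c U' c'. (U, c) \<in> \<xi> \<and> (U', c') \<in> \<eta>}),
      smult = (\<lambda>a \<xi>. \<Union>{coh_class X F W (U, \<lambda>x y. Res X W (U x \<inter> U y) a \<odot>\<^bsub>msec F (U x \<inter> U y)\<^esub> c x y)
              | U c. (U, c) \<in> \<xi>}) \<rparr>"

definition H1_res ::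
    "('p, 'r) rspace \<Rightarrow> ('p, 'r, 'm) msheaf \<Rightarrow> 'p set \<Rightarrow> ('p, 'm) cocycle set \<Rightarrow> ('p, 'm) cocycle set" where
  "H1_res X F W' \<xi> = \<Union>{coh_class X F W'
       (\<lambda>x. U x \<inter> W', \<lambda>x y. mres F (U x \<inter> U y) (U x \<inter> U y \<inter> W') (c x y)) | U c. (U, c) \<in> \<xi>}"

definition H1_map ::
    "('p, 'r) rspace \<Rightarrow> ('p, 'r, 'n) msheaf \<Rightarrow> ('p set \<Rightarrow> 'm \<Rightarrow> 'n) \<Rightarrow> 'p set \<Rightarrow>
     ('p, 'm) cocycle set \<Rightarrow> ('p, 'n) cocycle set" where
  "H1_map X G \<phi> W \<xi> = \<Union>{coh_class X G W (U, \<lambda>x y. \<phi> (U x \<inter> U y) (c x y)) | U c. (U, c) \<in> \<xi>}"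

text \<open>
  Euler characteristic \<open>h\<^sup>0 - h\<^sup>1\<close> of a sheaf on a scheme of dimension at most one that is proper over a
  field; \<open>q\<close> is the structure morphism, through which \<open>K\<close> acts.
\<close>

definition field_action :: "'k ring \<Rightarrow> ('p, 'r, 'k spec_pt, 'k spec_sec) rmor \<Rightarrow> 'k \<Rightarrow> 'r" where
  "field_action K q a = cmap q (points (Spec K)) (spec_const K a)"

definition h0_is ::
    "'k ring \<Rightarrow> ('p, 'r, 'k spec_pt, 'k spec_sec) rmor \<Rightarrow> ('p, 'r, 'm) msheaf \<Rightarrow> nat \<Rightarrow> bool" where
  "h0_is K q F n \<longleftrightarrow>
     vs_dim K (restrict_scalars (field_action K q) (msec F (points (src q)))) n"

definition h1_is ::
    "'k ring \<Rightarrow> ('p, 'r, 'k spec_pt, 'k spec_sec) rmor \<Rightarrow> ('p, 'r, 'm) msheaf \<Rightarrow> nat \<Rightarrow> bool" where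
  "h1_is K q F n \<longleftrightarrow>
     vs_dim K (restrict_scalars (field_action K q) (H1 (src q) F (points (src q)))) n"

definition euler_char_is ::
    "'k ring \<Rightarrow> ('p, 'r, 'k spec_pt, 'k spec_sec) rmor \<Rightarrow> ('p, 'r, 'm) msheaf \<Rightarrow> int \<Rightarrow> bool" where
  "euler_char_is K q F e \<longleftrightarrow> (\<exists>a b. h0_is K q F a \<and> h1_is K q F b \<and> e = int a - int b)"


section \<open>Line bundles\<close>

text \<open>
  A line bundle is given by transition functions for an open cover indexed by the points, with
  \<open>x \<in> nbd x\<close> (such covers are cofinal).  A section is a family \<open>s\<close> with \<open>s x = tfun x y \<cdot> s y\<close>.
\<close>

record ('p, 'r) line_bundle =
  nbd :: "'p \<Rightarrow> 'p set"
  tfun :: "'p \<Rightarrow> 'p \<Rightarrow> 'r"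

definition is_line_bundle :: "('p, 'r) rspace \<Rightarrow> ('p, 'r) line_bundle \<Rightarrow> bool" where
  "is_line_bundle X L \<longleftrightarrow>
     (\<forall>x \<in> points X. is_open X (nbd L x) \<and> x \<in> nbd L x) \<and>
     (\<forall>x \<in> points X. \<forall>y \<in> points X. tfun L x y \<in> Units (Sec X (nbd L x \<inter> nbd L y))) \<and>
     (\<forall>x \<in> points X. \<forall>y \<in> points X. \<forall>z \<in> points X. let D = nbd L x \<inter> nbd L y \<inter> nbd L z in
        Res X (nbd L x \<inter> nbd L z) D (tfun L x z) =
        Res X (nbd L x \<inter> nbd L y) D (tfun L x y) \<otimes>\<^bsub>Sec X D\<^esub> Res X (nbd L y \<inter> nbd L z) D (tfun L y z))"

definition lb_sheaf :: "('p, 'r) rspace \<Rightarrow> ('p, 'r) line_bundle \<Rightarrow> ('p, 'r, 'p \<Rightarrow> 'r) msheaf" where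
  "lb_sheaf X L =
    \<lparr> msec = (\<lambda>W.
        \<lparr> carrier = {s \<in> extensional (points X).
              (\<forall>x \<in> points X. s x \<in> carrier (Sec X (W \<inter> nbd L x))) \<and>
              (\<forall>x \<in> points X. \<forall>y \<in> points X. let D = W \<inter> nbd L x \<inter> nbd L y in
                 Res X (W \<inter> nbd L x) D (s x) =
                 Res X (nbd L x \<inter> nbd L y) D (tfun L x y) \<otimes>\<^bsub>Sec X D\<^esub> Res X (W \<inter> nbd L y) D (s y))},
          monoid.mult = undefined, monoid.one = undefined,
          ring.zero = (\<lambda>x\<in>points X. \<zero>\<^bsub>Sec X (W \<inter> nbd L x)\<^esub>),
          ring.add = (\<lambda>s t. \<lambda>x\<in>points X. s x \<oplus>\<^bsub>Sec X (W \<inter> nbd L x)\<^esub> t x),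
          smult = (\<lambda>a s. \<lambda>x\<in>points X. Res X W (W \<inter> nbd L x) a \<otimes>\<^bsub>Sec X (W \<inter> nbd L x)\<^esub> s x) \<rparr>),
      mres = (\<lambda>W W' s. \<lambda>x\<in>points X. Res X (W \<inter> nbd L x) (W' \<inter> nbd L x) (s x)) \<rparr>"

abbreviation global_sections :: "('p, 'r) rspace \<Rightarrow> ('p, 'r) line_bundle \<Rightarrow> ('p \<Rightarrow> 'r) set" where
  "global_sections X L \<equiv> carrier (msec (lb_sheaf X L) (points X))"

definition nonvanishing :: "('p, 'r) rspace \<Rightarrow> ('p, 'r) line_bundle \<Rightarrow> ('p \<Rightarrow> 'r) \<Rightarrow> 'p set" where
  "nonvanishing X L s = {x \<in> points X. germ X x (nbd L x) (s x) \<in> Units (stalk X x)}"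

definition lb_iso :: "('p, 'r) rspace \<Rightarrow> ('p, 'r) line_bundle \<Rightarrow> ('p, 'r) line_bundle \<Rightarrow> bool" where
  "lb_iso X L L' \<longleftrightarrow> (\<exists>U h.
     (\<forall>x \<in> points X. is_open X (U x) \<and> x \<in> U x \<and> U x \<subseteq> nbd L x \<inter> nbd L' x \<and> h x \<in> Units (Sec X (U x))) \<and>
     (\<forall>x \<in> points X. \<forall>y \<in> points X. let D = U x \<inter> U y in
        Res X (U x) D (h x) \<otimes>\<^bsub>Sec X D\<^esub> Res X (nbd L x \<inter> nbd L y) D (tfun L x y) =
        Res X (nbd L' x \<inter> nbd L' y) D (tfun L' x y) \<otimes>\<^bsub>Sec X D\<^esub> Res X (U y) D (h y)))"

definition lb_tensor ::
    "('p, 'r) rspace \<Rightarrow> ('p, 'r) line_bundle \<Rightarrow> ('p, 'r) line_bundle \<Rightarrow> ('p, 'r) line_bundle" where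
  "lb_tensor X L L' =
    \<lparr> nbd = (\<lambda>x. nbd L x \<inter> nbd L' x),
      tfun = (\<lambda>x y. let D = (nbd L x \<inter> nbd L' x) \<inter> (nbd L y \<inter> nbd L' y) in
        Res X (nbd L x \<inter> nbd L y) D (tfun L x y) \<otimes>\<^bsub>Sec X D\<^esub>
        Res X (nbd L' x \<inter> nbd L' y) D (tfun L' x y)) \<rparr>"

definition lb_power :: "('p, 'r) rspace \<Rightarrow> ('p, 'r) line_bundle \<Rightarrow> nat \<Rightarrow> ('p, 'r) line_bundle" where
  "lb_power X L n =
    \<lparr> nbd = nbd L, tfun = (\<lambda>x y. tfun L x y [^]\<^bsub>Sec X (nbd L x \<inter> nbd L y)\<^esub> n) \<rparr>"

text \<open>The tensor product of the bundles \<open>L i\<close> to the powers \<open>n i\<close>, for \<open>i\<close> in a finite set \<open>I\<close>.\<close>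

definition lb_product ::
    "('p, 'r) rspace \<Rightarrow> 'i set \<Rightarrow> ('i \<Rightarrow> ('p, 'r) line_bundle) \<Rightarrow> ('i \<Rightarrow> nat) \<Rightarrow> ('p, 'r) line_bundle" where
  "lb_product X I L n = (let N = (\<lambda>x. points X \<inter> (\<Inter>i\<in>I. nbd (L i) x)) in
    \<lparr> nbd = N,
      tfun = (\<lambda>x y. finprod (Sec X (N x \<inter> N y))
        (\<lambda>i. Res X (nbd (L i) x \<inter> nbd (L i) y) (N x \<inter> N y) (tfun (L i) x y)
               [^]\<^bsub>Sec X (N x \<inter> N y)\<^esub> n i) I) \<rparr>)"

definition lb_pullback :: "('p, 'a, 'q, 'b) rmor \<Rightarrow> ('q, 'b) line_bundle \<Rightarrow> ('p, 'a) line_bundle" where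
  "lb_pullback f L =
    \<lparr> nbd = (\<lambda>x. preim f (nbd L (pmap f x))),
      tfun = (\<lambda>x y. cmap f (nbd L (pmap f x) \<inter> nbd L (pmap f y)) (tfun L (pmap f x) (pmap f y))) \<rparr>"

definition lb_restrict :: "('p, 'r) rspace \<Rightarrow> ('p, 'r) line_bundle \<Rightarrow> 'p set \<Rightarrow> ('p, 'r) line_bundle" where
  "lb_restrict X L W =
    \<lparr> nbd = (\<lambda>x. nbd L x \<inter> W),
      tfun = (\<lambda>x y. Res X (nbd L x \<inter> nbd L y) (nbd L x \<inter> nbd L y \<inter> W) (tfun L x y)) \<rparr>"

definition ample :: "('p, 'r) rspace \<Rightarrow> ('p, 'r) line_bundle \<Rightarrow> bool" where
  "ample X L \<longleftrightarrow> scheme X \<and> compact_space (rtop X) \<and> is_line_bundle X L \<and>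
     (\<forall>x \<in> points X. \<exists>n\<ge>1. \<exists>s \<in> global_sections X (lb_power X L n).
        x \<in> nonvanishing X (lb_power X L n) s \<and> affine_open X (nonvanishing X (lb_power X L n) s))"

definition relatively_ample :: "('p, 'a, 'q, 'b) rmor \<Rightarrow> ('p, 'a) line_bundle \<Rightarrow> bool" where
  "relatively_ample f L \<longleftrightarrow> is_line_bundle (src f) L \<and>
     (\<forall>W. affine_open (tgt f) W \<longrightarrow>
        ample (open_sub (src f) (preim f W)) (lb_restrict (src f) L (preim f W)))"

text \<open>
  \<open>\<O>(1)\<close>: near \<open>P\<close> it is trivialized on \<open>x\<^sub>i \<noteq> 0\<close>, for the least \<open>i\<close> with \<open>x\<^sub>i \<notin> P\<close>; a linear form \<open>l\<close> is the
  section \<open>l / x\<^sub>i\<close> there.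
\<close>

definition proj_O1 :: "'k ring \<Rightarrow> nat \<Rightarrow> ('k proj_pt, 'k proj_sec) line_bundle" where
  "proj_O1 k n = (let i = (\<lambda>P. LEAST i. mvar k i \<notin> P);
                      D = (\<lambda>P. {Q \<in> proj_points k n. mvar k (i P) \<notin> Q}) in
    \<lparr> nbd = D,
      tfun = (\<lambda>P P'. \<lambda>Q \<in> D P \<inter> D P'.
        lfrac (mpoly_ring k (Suc n)) (proj_mult_set k n Q) (mvar k (i P')) (mvar k (i P))) \<rparr>)"


section \<open>Projective varieties and curve classes\<close>

text \<open>\<open>v\<close> is the structure morphism of \<open>V\<close>.\<close>

definition projective_embedding ::
    "'k ring \<Rightarrow> ('v, 'r, 'k spec_pt, 'k spec_sec) rmor \<Rightarrow> nat \<Rightarrow>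
     ('v, 'r, 'k proj_pt, 'k proj_sec) rmor \<Rightarrow> bool" where
  "projective_embedding k v n i \<longleftrightarrow>
     i \<in> Mor (src v) (Proj k n) \<and> closed_immersion i \<and> proj_structure k n \<bullet> i = v"

definition projective_variety :: "'k ring \<Rightarrow> ('v, 'r, 'k spec_pt, 'k spec_sec) rmor \<Rightarrow> bool" where
  "projective_variety k v \<longleftrightarrow> v \<in> Mor (src v) (Spec k) \<and> integral_scheme (src v) \<and>
     (\<exists>n i. projective_embedding k v n i)"

text \<open>Since \<open>V\<close> is proper, immersions of \<open>V\<close> into projective space are closed.\<close>

definition very_ample ::
    "'k ring \<Rightarrow> ('v, 'r, 'k spec_pt, 'k spec_sec) rmor \<Rightarrow> ('v, 'r) line_bundle \<Rightarrow> bool" where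
  "very_ample k v L \<longleftrightarrow> is_line_bundle (src v) L \<and>
     (\<exists>n i. projective_embedding k v n i \<and> lb_iso (src v) L (lb_pullback i (proj_O1 k n)))"

text \<open>
  Degree of a line bundle on a (possibly singular or reducible) proper curve, by Riemann--Roch:
  \<open>deg L = \<chi>(L) - \<chi>(\<O>)\<close>.
\<close>

definition degree_is ::
    "'k ring \<Rightarrow> ('p, 'r, 'k spec_pt, 'k spec_sec) rmor \<Rightarrow> ('p, 'r) line_bundle \<Rightarrow> int \<Rightarrow> bool" where
  "degree_is K q L d \<longleftrightarrow>
     (\<exists>e e0. euler_char_is K q (lb_sheaf (src q) L) e \<and>
        euler_char_is K q (structure_sheaf (src q)) e0 \<and> d = e - e0)"

text \<open>
  A numerical class is the function \<open>L \<mapsto> \<beta> \<cdot> L\<close>.  It is effective if it is the class of a cycle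
  \<open>\<Sum> n\<^sub>j Z\<^sub>j\<close>, \<open>n\<^sub>j \<ge> 0\<close>, with integral closed curves \<open>i\<^sub>j: Z\<^sub>j \<rightarrow> V\<close>; such curves can be realized on the types
  of \<open>V\<close>.  The zero cycle is included.
\<close>

definition integral_curve_in :: "('v, 'r, 'v, 'r) rmor \<Rightarrow> ('v, 'r) rspace \<Rightarrow> bool" where
  "integral_curve_in i V \<longleftrightarrow> closed_immersion i \<and> tgt i = V \<and> integral_scheme (src i) \<and>
     top_dim (rtop (src i)) 1"

definition effective_class ::
    "'k ring \<Rightarrow> ('v, 'r, 'k spec_pt, 'k spec_sec) rmor \<Rightarrow> (('v, 'r) line_bundle \<Rightarrow> int) \<Rightarrow> bool" where
  "effective_class k v \<beta> \<longleftrightarrow> (\<exists>(m :: nat) (n :: nat \<Rightarrow> nat) i.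
     (\<forall>j<m. integral_curve_in (i j) (src v)) \<and>
     (\<forall>L. is_line_bundle (src v) L \<longrightarrow>
        (\<exists>d. (\<forall>j<m. degree_is k (v \<bullet> i j) (lb_pullback (i j) L) (d j)) \<and>
             \<beta> L = (\<Sum>j<m. int (n j) * d j))))"


section \<open>Nodal curves, dualizing sheaves, divisors of sections\<close>

definition nodal_curve :: "nat \<Rightarrow> ('c, 'b, 't, 'a) rmor \<Rightarrow> bool" where
  "nodal_curve g \<pi> \<longleftrightarrow>
     \<pi> \<in> Mor (src \<pi>) (tgt \<pi>) \<and> scheme (src \<pi>) \<and> scheme (tgt \<pi>) \<and> proper \<pi> \<and>
     (\<forall>x \<in> points (src \<pi>). flat_at \<pi> x) \<and>
     (\<forall>K p q. geometric_fibre \<pi> K p q \<longrightarrow>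
        points (src p) \<noteq> {} \<and> connected_space (rtop (src p)) \<and>
        (\<forall>Z. irreducible_component (rtop (src p)) Z \<longrightarrow> top_dim (subtopology (rtop (src p)) Z) 1) \<and>
        h1_is K q (structure_sheaf (src p)) g \<and>
        (\<forall>y \<in> points (src p). closedin (rtop (src p)) {y} \<longrightarrow>
           regular_local_ring (stalk (src p) y) \<or> node K (src p) y))"

text \<open>
  Homomorphisms from \<open>R\<^sup>1\<pi>\<^sub>*F\<close> to the structure sheaf of the base.  As \<open>R\<^sup>1\<pi>\<^sub>*F\<close> is the sheaf associated with
  \<open>W \<mapsto> H\<^sup>1(\<pi>\<^sup>-\<^sup>1W, F)\<close>, these are the homomorphisms defined on this presheaf.
\<close>

definition R1_functional ::
    "('c, 'b, 't, 'a) rmor \<Rightarrow> ('c, 'b, 'm) msheaf \<Rightarrow> ('t set \<Rightarrow> ('c, 'm) cocycle set \<Rightarrow> 'a) \<Rightarrow> bool" where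
  "R1_functional \<pi> F \<tau> \<longleftrightarrow>
     (\<forall>W. is_open (tgt \<pi>) W \<longrightarrow> (let H = H1 (src \<pi>) F (preim \<pi> W) in
        \<forall>\<xi> \<in> carrier H. \<tau> W \<xi> \<in> carrier (Sec (tgt \<pi>) W) \<and>
          (\<forall>\<eta> \<in> carrier H. \<tau> W (\<xi> \<oplus>\<^bsub>H\<^esub> \<eta>) = \<tau> W \<xi> \<oplus>\<^bsub>Sec (tgt \<pi>) W\<^esub> \<tau> W \<eta>) \<and>
          (\<forall>a \<in> carrier (Sec (tgt \<pi>) W). \<tau> W (cmap \<pi> W a \<odot>\<^bsub>H\<^esub> \<xi>) = a \<otimes>\<^bsub>Sec (tgt \<pi>) W\<^esub> \<tau> W \<xi>) \<and>
          (\<forall>W'. is_open (tgt \<pi>) W' \<and> W' \<subseteq> W \<longrightarrow>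
             \<tau> W' (H1_res (src \<pi>) F (preim \<pi> W') \<xi>) = Res (tgt \<pi>) W W' (\<tau> W \<xi>))))"

text \<open>
  The line bundle \<open>\<omega>\<close> is a relative dualizing sheaf \<open>K\<^sub>\<pi>\<close> if, with a suitable trace map \<open>tr\<close>, it
  represents the functor \<open>F \<mapsto> Hom(R\<^sup>1\<pi>\<^sub>*F, \<O>\<^sub>T)\<close> on quasi-coherent sheaves.  The sheaves \<open>F\<close> on the type
  below include all line bundles, so the property determines \<open>\<omega>\<close> up to isomorphism.
\<close>

definition relative_dualizing :: "('c, 'b, 't, 'a) rmor \<Rightarrow> ('c, 'b) line_bundle \<Rightarrow> bool" where
  "relative_dualizing \<pi> \<omega> \<longleftrightarrow> is_line_bundle (src \<pi>) \<omega> \<and>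
     (\<exists>tr. R1_functional \<pi> (lb_sheaf (src \<pi>) \<omega>) tr \<and>
        (\<forall>(F :: ('c, 'b, 'c \<Rightarrow> 'b) msheaf) \<tau>. quasi_coherent (src \<pi>) F \<and> R1_functional \<pi> F \<tau> \<longrightarrow>
           (\<exists>!\<phi>. \<phi> \<in> msheaf_hom (src \<pi>) F (lb_sheaf (src \<pi>) \<omega>) \<and>
              (\<forall>W. is_open (tgt \<pi>) W \<longrightarrow>
                 (\<forall>\<xi> \<in> carrier (H1 (src \<pi>) F (preim \<pi> W)).
                    \<tau> W \<xi> = tr W (H1_map (src \<pi>) (lb_sheaf (src \<pi>) \<omega>) \<phi> (preim \<pi> W) \<xi>))))))"

text \<open>
  \<open>D\<close> is the line bundle \<open>\<O>(s)\<close> of the effective Cartier divisor given by the image of the section \<open>s\<close>: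
  it has a global section whose local components are nonzerodivisors that generate the ideal sheaf
  of the image.
\<close>

definition section_divisor_bundle :: "('t, 'a, 'c, 'b) rmor \<Rightarrow> ('c, 'b) line_bundle \<Rightarrow> bool" where
  "section_divisor_bundle s D \<longleftrightarrow> (let C = tgt s in is_line_bundle C D \<and>
     (\<exists>e \<in> global_sections C D. \<forall>x \<in> points C. \<forall>W. is_open C W \<and> W \<subseteq> nbd D x \<longrightarrow>
        (\<forall>b \<in> carrier (Sec C W). Res C (nbd D x) W (e x) \<otimes>\<^bsub>Sec C W\<^esub> b = \<zero>\<^bsub>Sec C W\<^esub> \<longrightarrow> b = \<zero>\<^bsub>Sec C W\<^esub>) \<and>
        {b \<in> carrier (Sec C W). cmap s W b = \<zero>\<^bsub>Sec (src s) (preim s W)\<^esub>} =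
        {Res C (nbd D x) W (e x) \<otimes>\<^bsub>Sec C W\<^esub> b | b. b \<in> carrier (Sec C W)}))"


section \<open>Stable maps with weighted markings\<close>

text \<open>
  Data \<open>(C, \<pi>, s, f)\<close> over a \<open>k\<close>-scheme \<open>T\<close> with structure morphism \<open>base\<close>; \<open>C\<close> and \<open>T\<close> are source and
  target of \<open>curve = \<pi>\<close>.
\<close>

record ('i, 't, 'a, 'c, 'b, 'v, 'r, 'k) family =
  base :: "('t, 'a, 'k spec_pt, 'k spec_sec) rmor"
  curve :: "('c, 'b, 't, 'a) rmor"
  sect :: "'i \<Rightarrow> ('t, 'a, 'c, 'b) rmor"
  emap :: "('c, 'b, 'v, 'r) rmor"

definition weight_data ::
    "'k ring \<Rightarrow> ('v, 'r, 'k spec_pt, 'k spec_sec) rmor \<Rightarrow> 'i set \<Rightarrow> ('i \<Rightarrow> rat) \<Rightarrow>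
     (('v, 'r) line_bundle \<Rightarrow> int) \<Rightarrow> bool" where
  "weight_data k v S A \<beta> \<longleftrightarrow> finite S \<and> (\<forall>i\<in>S. 0 \<le> A i \<and> A i \<le> 1) \<and> effective_class k v \<beta>"

definition admissible ::
    "'k ring \<Rightarrow> ('v, 'r, 'k spec_pt, 'k spec_sec) rmor \<Rightarrow> nat \<Rightarrow> 'i set \<Rightarrow> ('i \<Rightarrow> rat) \<Rightarrow>
     (('v, 'r) line_bundle \<Rightarrow> int) \<Rightarrow> bool" where
  "admissible k v g S A \<beta> \<longleftrightarrow> weight_data k v S A \<beta> \<and>
     ((\<exists>L. is_line_bundle (src v) L \<and> \<beta> L \<noteq> 0) \<or> 2 * of_nat g - 2 + (\<Sum>i\<in>S. A i) > 0) \<and>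
     (ring_char k = 0 \<or> (\<exists>L. very_ample k v L \<and> \<beta> L < int (ring_char k)))"

text \<open>
  The condition \<open>f\<^sub>*[C] = \<beta>\<close> on a geometric fibre \<open>F\<close> says, by the projection formula, that the pullback of
  each line bundle \<open>L\<close> on \<open>V\<close> to \<open>F\<close> has degree \<open>\<beta> \<cdot> L\<close>.
\<close>

definition prestable_map ::
    "'k ring \<Rightarrow> ('v, 'r, 'k spec_pt, 'k spec_sec) rmor \<Rightarrow> nat \<Rightarrow> 'i set \<Rightarrow> ('i \<Rightarrow> rat) \<Rightarrow>
     (('v, 'r) line_bundle \<Rightarrow> int) \<Rightarrow> ('i, 't, 'a, 'c, 'b, 'v, 'r, 'k) family \<Rightarrow> bool" where
  "prestable_map k v g S A \<beta> X \<longleftrightarrow>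
     (let \<pi> = curve X; C = src \<pi>; T = tgt \<pi>; s = sect X; f = emap X in
        base X \<in> Mor T (Spec k) \<and> nodal_curve g \<pi> \<and>
        s \<in> extensional S \<and> (\<forall>i\<in>S. s i \<in> Mor T C \<and> \<pi> \<bullet> s i = mid T) \<and>
        f \<in> Mor C (src v) \<and> v \<bullet> f = base X \<bullet> \<pi> \<and>
        (\<forall>K p q. geometric_fibre \<pi> K p q \<longrightarrow>
           (\<forall>L. is_line_bundle (src v) L \<longrightarrow> degree_is K q (lb_pullback (f \<bullet> p) L) (\<beta> L))) \<and>
        (\<forall>i\<in>S. A i > 0 \<longrightarrow> (\<forall>t \<in> points T. smooth_at \<pi> (pmap (s i) t))) \<and>
        (\<forall>I \<subseteq> S. points C \<inter> (\<Inter>i\<in>I. pmap (s i) ` points T) \<noteq> {} \<longrightarrow> (\<Sum>i\<in>I. A i) \<le> 1))"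

text \<open>
  Ampleness of the \<open>\<rat>\<close>-divisor \<open>K\<^sub>\<pi> + \<Sum> A(i) s\<^sub>i + 3 f\<^sup>*M\<close> is ampleness of a positive integral multiple \<open>N\<close>.
  Sections of weight zero, whose images need not be Cartier divisors, do not contribute.
\<close>

definition stable_map ::
    "'k ring \<Rightarrow> ('v, 'r, 'k spec_pt, 'k spec_sec) rmor \<Rightarrow> nat \<Rightarrow> 'i set \<Rightarrow> ('i \<Rightarrow> rat) \<Rightarrow>
     (('v, 'r) line_bundle \<Rightarrow> int) \<Rightarrow> ('i, 't, 'a, 'c, 'b, 'v, 'r, 'k) family \<Rightarrow> bool" where
  "stable_map k v g S A \<beta> X \<longleftrightarrow> prestable_map k v g S A \<beta> X \<and>
     (let \<pi> = curve X; C = src \<pi>; f = emap X; P = {i \<in> S. A i > 0} in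
        \<exists>M. ample (src v) M \<and>
        (\<exists>(N :: nat) n \<omega> D. N > 0 \<and> (\<forall>i\<in>P. of_nat (n i) = of_nat N * A i) \<and>
           relative_dualizing \<pi> \<omega> \<and>
           (\<forall>i\<in>P. section_divisor_bundle (sect X i) (D i)) \<and>
           relatively_ample \<pi>
             (lb_tensor C (lb_tensor C (lb_power C \<omega> N) (lb_product C P D n))
                (lb_power C (lb_pullback f M) (3 * N)))))"


section \<open>The moduli stack and morphisms of stacks\<close>

text \<open>
  A category over a base category: objects, arrows between two objects, identities, composition
  (in the order of functions), and the projection functor to the base on objects and on arrows.
\<close>

record ('o, 'm, 'x, 'y) fibred_category =
  Obj :: "'o set"
  Arr :: "'o \<Rightarrow> 'o \<Rightarrow> 'm set"
  Ident :: "'o \<Rightarrow> 'm"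
  Comp :: "'m \<Rightarrow> 'm \<Rightarrow> 'm"
  proj_obj :: "'o \<Rightarrow> 'x"
  proj_arr :: "'m \<Rightarrow> 'y"

text \<open>
  A 1-morphism of categories fibred in groupoids over the same base is a functor that commutes with
  the projections (on the nose).
\<close>

definition stack_morphism ::
    "('o, 'm, 'x, 'y) fibred_category \<Rightarrow> ('p, 'n, 'x, 'y) fibred_category \<Rightarrow>
     ('o \<Rightarrow> 'p) \<Rightarrow> ('m \<Rightarrow> 'n) \<Rightarrow> bool" where
  "stack_morphism \<C> \<D> \<Phi> \<Psi> \<longleftrightarrow>
     (\<forall>X \<in> Obj \<C>. \<Phi> X \<in> Obj \<D> \<and> proj_obj \<D> (\<Phi> X) = proj_obj \<C> X \<and> \<Psi> (Ident \<C> X) = Ident \<D> (\<Phi> X)) \<and>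
     (\<forall>X \<in> Obj \<C>. \<forall>Y \<in> Obj \<C>. \<forall>a \<in> Arr \<C> X Y.
        \<Psi> a \<in> Arr \<D> (\<Phi> X) (\<Phi> Y) \<and> proj_arr \<D> (\<Psi> a) = proj_arr \<C> a) \<and>
     (\<forall>X \<in> Obj \<C>. \<forall>Y \<in> Obj \<C>. \<forall>Z \<in> Obj \<C>. \<forall>a \<in> Arr \<C> X Y. \<forall>b \<in> Arr \<C> Y Z.
        \<Psi> (Comp \<C> b a) = Comp \<D> (\<Psi> b) (\<Psi> a))"

text \<open>
  Objects are the stable maps over arbitrary \<open>k\<close>-schemes \<open>T\<close>.  An arrow from \<open>(C', \<pi>', s', f')\<close> over
  \<open>T'\<close> to \<open>(C, \<pi>, s, f)\<close> over \<open>T\<close> is a pair of a \<open>k\<close>-morphism \<open>a: T' \<rightarrow> T\<close> and a morphism \<open>b: C' \<rightarrow> C\<close>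
  that identify the first family with the pullback of the second; for \<open>a = id\<close> these are the
  isomorphisms.  The base is the
  category of \<open>k\<close>-schemes, an object of which is given by its structure morphism.
\<close>

type_synonym ('i, 't, 'a, 'c, 'b, 'v, 'r, 'k) moduli =
  "(('i, 't, 'a, 'c, 'b, 'v, 'r, 'k) family, ('t, 'a, 't, 'a) rmor \<times> ('c, 'b, 'c, 'b) rmor,
    ('t, 'a, 'k spec_pt, 'k spec_sec) rmor, ('t, 'a, 't, 'a) rmor) fibred_category"

definition Mbar ::
    "'k ring \<Rightarrow> ('v, 'r, 'k spec_pt, 'k spec_sec) rmor \<Rightarrow> nat \<Rightarrow> 'i set \<Rightarrow> ('i \<Rightarrow> rat) \<Rightarrow>
     (('v, 'r) line_bundle \<Rightarrow> int) \<Rightarrow> ('i, 't, 'a, 'c, 'b, 'v, 'r, 'k) moduli" where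
  "Mbar k v g S A \<beta> =
    \<lparr> Obj = {X. stable_map k v g S A \<beta> X},
      Arr = (\<lambda>X' X. {(a, b).
        a \<in> Mor (tgt (curve X')) (tgt (curve X)) \<and> base X \<bullet> a = base X' \<and>
        b \<in> Mor (src (curve X')) (src (curve X)) \<and> is_pullback b (curve X') (curve X) a \<and>
        (\<forall>i\<in>S. b \<bullet> sect X' i = sect X i \<bullet> a) \<and> emap X \<bullet> b = emap X'}),
      Ident = (\<lambda>X. (mid (tgt (curve X)), mid (src (curve X)))),
      Comp = (\<lambda>(a', b') (a, b). (a' \<bullet> a, b' \<bullet> b)),
      proj_obj = base,
      proj_arr = fst \<rparr>"

text \<open>
  The label set \<open>S' \<squnion> {*}\<close> is a set of options, with \<open>*\<close> rendered as \<open>None\<close>.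
\<close>

definition starred_labels :: "'i set \<Rightarrow> 'i option set" where
  "starred_labels S' = insert None (Some ` S')"

definition starred_weights :: "('i \<Rightarrow> rat) \<Rightarrow> rat \<Rightarrow> 'i option \<Rightarrow> rat" where
  "starred_weights A a j = (case j of None \<Rightarrow> a | Some i \<Rightarrow> A i)"

definition duplicate_section ::
    "'i set \<Rightarrow> 'i set \<Rightarrow> ('i option, 't, 'a, 'c, 'b, 'v, 'r, 'k) family \<Rightarrow>
     ('i, 't, 'a, 'c, 'b, 'v, 'r, 'k) family" where
  "duplicate_section S' S'' X =
    \<lparr> base = base X, curve = curve X,
      sect = (\<lambda>i\<in>S' \<union> S''. if i \<in> S'' then sect X None else sect X (Some i)),
      emap = emap X \<rparr>"

end

theory Submission
  imports Defs
begin

text \<open>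
  Replacing \<open>s\<^sub>*\<close> by equal sections \<open>s\<^sub>i\<close>, \<open>i \<in> S''\<close>, is pulling back sections along the map of labels
  \<open>\<phi>: S \<rightarrow> S' \<squnion> {*}\<close> that collapses \<open>S''\<close> to \<open>*\<close>.  All that matters about \<open>\<phi>\<close> is that the weight
  \<open>B(j)\<close> of a label is the sum of the weights \<open>A(i)\<close> over the fibre of \<open>j\<close>, and for every such
  \<open>\<phi>: S \<rightarrow> T\<close> the assignment \<open>(C, \<pi>, s, f) \<mapsto> (C, \<pi>, s \<circ> \<phi>, f)\<close> preserves stability.

  A label of positive weight lies over a label of positive weight, so its section runs in the smooth
  locus.  If the sections with labels in \<open>I\<close> meet, then so do those with labels in \<open>\<phi>(I)\<close>, and
  \<open>A(I) \<le> B(\<phi>(I)) \<le> 1\<close> because weights are nonnegative.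

  The divisor \<open>K\<^sub>\<pi> + \<Sum> A(i) s\<^sub>\<phi>\<^sub>(\<^sub>i\<^sub>) + 3 f\<^sup>*M\<close> is the old one, \<open>K\<^sub>\<pi> + \<Sum> B(j) s\<^sub>j + 3 f\<^sup>*M\<close>, but it is a
  \<open>\<rat>\<close>-divisor, and ampleness is a statement about an integral multiple.  A multiple \<open>N\<close> that makes the
  numbers \<open>B(j)\<close> integral need not do so for the \<open>A(i)\<close> (consider \<open>1/2 + 1/2 = 1\<close>).  So one passes from
  \<open>N\<close> to \<open>N m\<close>, where \<open>m\<close> is a common denominator of the \<open>A(i)\<close>.  This needs two facts: the line bundle
  for \<open>N m\<close> and the \<open>A(i)\<close> is the \<open>m\<close>-th power of the one for \<open>N\<close> and the \<open>B(j)\<close>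
  (\<open>same_bundle_product_fibres\<close> and the compatibility of powers with tensor products), and powers of
  relatively ample bundles are relatively ample (\<open>relatively_ample_power\<close>).  As line bundles are
  given by transition functions, the first fact is an equality of transition functions, not just
  an isomorphism.

  An arrow of families commutes with the sections \<open>s\<close>, hence with \<open>s \<circ> \<phi>\<close>, so the functor leaves
  arrows as they are.
\<close>

section \<open>Powers in rings and monoids\<close>

lemma (in comm_monoid) Units_nat_pow_iff:
  assumes "a \<in> carrier G" and "0 < (n::nat)"
  shows "a [^] n \<in> Units G \<longleftrightarrow> a \<in> Units G"
proof
  assume "a [^] n \<in> Units G"
  moreover from \<open>0 < n\<close> obtain m where "n = Suc m"
    by (cases n) auto
  ultimately have "a \<otimes> a [^] m \<in> Units G"
    using assms(1) by (simp add: m_comm)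
  then show "a \<in> Units G"
    using assms(1) unit_factor by blast
next
  show "a \<in> Units G \<Longrightarrow> a [^] n \<in> Units G"
    by (induction n) auto
qed

lemma (in comm_monoid) finprod_nat_pow:
  assumes "finite I" and "f \<in> I \<rightarrow> carrier G"
  shows "finprod G f I [^] (n::nat) = finprod G (\<lambda>i. f i [^] n) I"
  using assms by (induction I) (auto simp: nat_pow_distrib Pi_iff)

lemma (in comm_monoid) finprod_const_base:
  assumes "finite I" and "a \<in> carrier G"
  shows "finprod G (\<lambda>i. a [^] (n i :: nat)) I = a [^] (\<Sum>i\<in>I. n i)"
  using assms by (induction I) (auto simp: nat_pow_mult)

lemma (in comm_monoid) finprod_over_fibres:
  assumes "finite J" and "f \<in> J \<rightarrow> carrier G"
  shows "finprod G f J = finprod G (\<lambda>i. finprod G f {j \<in> J. \<phi> j = i}) (\<phi> ` J)"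
proof -
  have "finprod G f J = finprod G f (\<Union>i\<in>\<phi> ` J. {j \<in> J. \<phi> j = i})"
    by (rule arg_cong[where f = "finprod G f"]) auto
  also have "\<dots> = finprod G (\<lambda>i. finprod G f {j \<in> J. \<phi> j = i}) (\<phi> ` J)"
    using assms by (intro finprod_UN_disjoint) (auto simp: pairwise_def disjnt_def)
  finally show ?thesis .
qed

lemma ring_hom_nat_pow:
  assumes "h \<in> ring_hom R S" and "cring R" and "cring S" and "a \<in> carrier R"
  shows "h (a [^]\<^bsub>R\<^esub> (n::nat)) = h a [^]\<^bsub>S\<^esub> n"
proof -
  interpret R: cring R by fact
  interpret S: cring S by fact
  show ?thesis
    by (induction n) (use assms in \<open>auto simp: ring_hom_one ring_hom_mult\<close>)
qed

section \<open>Germs of powers\<close>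

context
  fixes X :: "('p, 'r) rspace"
  assumes X: "ringed_space X"
begin

private lemmas sheaf_axioms = X[unfolded ringed_space_def]

lemma cring_Sec: "is_open X U \<Longrightarrow> cring (Sec X U)"
  by (rule sheaf_axioms[THEN conjunct1, rule_format])

lemma Res_hom: "\<lbrakk>is_open X U; is_open X W; W \<subseteq> U\<rbrakk> \<Longrightarrow> Res X U W \<in> ring_hom (Sec X U) (Sec X W)"
  by (rule sheaf_axioms[THEN conjunct2, THEN conjunct1, rule_format]) auto

lemma Res_self: "\<lbrakk>is_open X U; s \<in> carrier (Sec X U)\<rbrakk> \<Longrightarrow> Res X U U s = s"
  by (rule sheaf_axioms[THEN conjunct2, THEN conjunct2, THEN conjunct1, rule_format]) auto

lemma Res_Res:
  "\<lbrakk>is_open X U; is_open X W; is_open X Z; Z \<subseteq> W; W \<subseteq> U; s \<in> carrier (Sec X U)\<rbrakk>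
    \<Longrightarrow> Res X W Z (Res X U W s) = Res X U Z s"
  by (rule sheaf_axioms[THEN conjunct2, THEN conjunct2, THEN conjunct2, THEN conjunct1, rule_format]) auto

end

lemma Res_closed:
  assumes "ringed_space X" and "is_open X U" and "is_open X W" and "W \<subseteq> U" and "s \<in> carrier (Sec X U)"
  shows "Res X U W s \<in> carrier (Sec X W)"
  using ring_hom_closed[OF Res_hom] assms by metis

lemma Res_mult:
  assumes "ringed_space X" and "is_open X U" and "is_open X W" and "W \<subseteq> U"
    and "s \<in> carrier (Sec X U)" and "t \<in> carrier (Sec X U)"
  shows "Res X U W (s \<otimes>\<^bsub>Sec X U\<^esub> t) = Res X U W s \<otimes>\<^bsub>Sec X W\<^esub> Res X U W t"
  using ring_hom_mult[OF Res_hom] assms by metis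

lemma Res_pow:
  assumes "ringed_space X" and "is_open X U" and "is_open X W" and "W \<subseteq> U" and "s \<in> carrier (Sec X U)"
  shows "Res X U W (s [^]\<^bsub>Sec X U\<^esub> (n::nat)) = Res X U W s [^]\<^bsub>Sec X W\<^esub> n"
  using ring_hom_nat_pow[OF Res_hom cring_Sec cring_Sec] assms by metis

lemma Res_eq_smaller:
  assumes "ringed_space X" and "is_open X U" and "is_open X W" and "is_open X Z" and "is_open X Z'"
    and "Z' \<subseteq> Z" and "Z \<subseteq> U \<inter> W" and "s \<in> carrier (Sec X U)" and "t \<in> carrier (Sec X W)"
    and "Res X U Z s = Res X W Z t"
  shows "Res X U Z' s = Res X W Z' t"
  using assms Res_Res[OF assms(1), of U Z Z' s] Res_Res[OF assms(1), of W Z Z' t] by simp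

lemma germ_iff:
  "(W, t) \<in> germ X x U s \<longleftrightarrow> is_open X W \<and> x \<in> W \<and> t \<in> carrier (Sec X W) \<and>
     (\<exists>Z. is_open X Z \<and> x \<in> Z \<and> Z \<subseteq> U \<inter> W \<and> Res X U Z s = Res X W Z t)"
  unfolding germ_def by simp

text \<open>
  Equality of sections on some neighbourhood of a point is transitive: shrink to the intersection of
  the two neighbourhoods.
\<close>

lemma germ_transfer:
  assumes X: "ringed_space X" and op: "is_open X U" "is_open X W" "is_open X Z"
    and Z: "x \<in> Z" "Z \<subseteq> U \<inter> W"
    and s: "s \<in> carrier (Sec X U)" and t: "t \<in> carrier (Sec X W)"
    and eq: "Res X U Z s = Res X W Z t"
  shows "germ X x U s \<subseteq> germ X x W t"
proof
  fix a assume a: "a \<in> germ X x U s"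
  obtain Y r where ar: "a = (Y, r)" by (cases a)
  from a obtain Z1 where Y: "is_open X Y" "x \<in> Y" "r \<in> carrier (Sec X Y)"
    and Z1: "is_open X Z1" "x \<in> Z1" "Z1 \<subseteq> U \<inter> Y" "Res X U Z1 s = Res X Y Z1 r"
    unfolding ar germ_iff by blast
  have o: "is_open X (Z \<inter> Z1)" using op Z1 by blast
  have "Res X U (Z \<inter> Z1) s = Res X W (Z \<inter> Z1) t"
    by (rule Res_eq_smaller[OF X op(1,2,3) o _ Z(2) s t eq]) auto
  moreover have "Res X U (Z \<inter> Z1) s = Res X Y (Z \<inter> Z1) r"
    by (rule Res_eq_smaller[OF X op(1) Y(1) Z1(1) o _ Z1(3) s Y(3) Z1(4)]) auto
  ultimately have "Res X W (Z \<inter> Z1) t = Res X Y (Z \<inter> Z1) r" by simp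
  moreover have "Z \<inter> Z1 \<subseteq> W \<inter> Y" "x \<in> Z \<inter> Z1" using Z Z1 by auto
  ultimately show "a \<in> germ X x W t"
    unfolding ar germ_iff using Y o by blast
qed

lemma germ_eqI:
  assumes X: "ringed_space X" and op: "is_open X U" "is_open X W" "is_open X Z"
    and Z: "x \<in> Z" "Z \<subseteq> U \<inter> W"
    and s: "s \<in> carrier (Sec X U)" and t: "t \<in> carrier (Sec X W)"
    and eq: "Res X U Z s = Res X W Z t"
  shows "germ X x U s = germ X x W t"
  using germ_transfer[OF X op Z s t eq] germ_transfer[OF X op(2,1,3) Z(1) _ t s eq[symmetric]] Z
  by blast

lemma germ_self:
  assumes "is_open X U" and "x \<in> U" and "s \<in> carrier (Sec X U)"
  shows "(U, s) \<in> germ X x U s"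
  using assms unfolding germ_iff by blast

text \<open>
  Stalk multiplication is a union over all representatives; every one of them contributes the
  germ of the product, since all of them agree with the given sections near the point.
\<close>

lemma germ_mult:
  assumes X: "ringed_space X" and U: "is_open X U" "x \<in> U"
    and s: "s \<in> carrier (Sec X U)" and t: "t \<in> carrier (Sec X U)"
  shows "germ X x U s \<otimes>\<^bsub>stalk X x\<^esub> germ X x U t = germ X x U (s \<otimes>\<^bsub>Sec X U\<^esub> t)"
proof -
  interpret SU: cring "Sec X U" using cring_Sec[OF X] U by blast
  let ?g = "\<lambda>W a Y b. germ X x (W \<inter> Y) (Res X W (W \<inter> Y) a \<otimes>\<^bsub>Sec X (W \<inter> Y)\<^esub> Res X Y (W \<inter> Y) b)"
  have eq: "?g W a Y b = germ X x U (s \<otimes>\<^bsub>Sec X U\<^esub> t)"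
    if a: "(W, a) \<in> germ X x U s" and b: "(Y, b) \<in> germ X x U t" for W a Y b
  proof -
    from a obtain Z1 where W: "is_open X W" "x \<in> W" "a \<in> carrier (Sec X W)"
      and Z1: "is_open X Z1" "x \<in> Z1" "Z1 \<subseteq> U \<inter> W" "Res X U Z1 s = Res X W Z1 a"
      unfolding germ_iff by blast
    from b obtain Z2 where Y: "is_open X Y" "x \<in> Y" "b \<in> carrier (Sec X Y)"
      and Z2: "is_open X Z2" "x \<in> Z2" "Z2 \<subseteq> U \<inter> Y" "Res X U Z2 t = Res X Y Z2 b"
      unfolding germ_iff by blast
    define Z where "Z = Z1 \<inter> Z2"
    have Z: "is_open X Z" "x \<in> Z" "Z \<subseteq> U" "Z \<subseteq> W" "Z \<subseteq> Y" "Z \<subseteq> Z1" "Z \<subseteq> Z2"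
      using Z1 Z2 unfolding Z_def by auto
    have WY: "is_open X (W \<inter> Y)" using W Y by blast
    interpret SW: cring "Sec X (W \<inter> Y)" using cring_Sec[OF X WY] .
    have c: "Res X W (W \<inter> Y) a \<in> carrier (Sec X (W \<inter> Y))" "Res X Y (W \<inter> Y) b \<in> carrier (Sec X (W \<inter> Y))"
      using Res_closed[OF X] W Y WY by auto
    have ra: "Res X U Z s = Res X W Z a"
      by (rule Res_eq_smaller[OF X U(1) W(1) Z1(1) Z(1) Z(6) Z1(3) s W(3) Z1(4)])
    have rb: "Res X U Z t = Res X Y Z b"
      by (rule Res_eq_smaller[OF X U(1) Y(1) Z2(1) Z(1) Z(7) Z2(3) t Y(3) Z2(4)])
    have "Res X (W \<inter> Y) Z (Res X W (W \<inter> Y) a \<otimes>\<^bsub>Sec X (W \<inter> Y)\<^esub> Res X Y (W \<inter> Y) b)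
        = Res X W Z a \<otimes>\<^bsub>Sec X Z\<^esub> Res X Y Z b"
      using Res_mult[OF X WY Z(1) _ c] Res_Res[OF X W(1) WY Z(1) _ _ W(3)]
        Res_Res[OF X Y(1) WY Z(1) _ _ Y(3)] Z by simp
    also have "\<dots> = Res X U Z (s \<otimes>\<^bsub>Sec X U\<^esub> t)"
      using Res_mult[OF X U(1) Z(1) Z(3) s t] ra rb by simp
    finally show ?thesis
      using Z s t c by (intro germ_eqI[OF X WY U(1) Z(1)]) auto
  qed
  have "germ X x U s \<otimes>\<^bsub>stalk X x\<^esub> germ X x U t
      = \<Union>{?g W a Y b | W a Y b. (W, a) \<in> germ X x U s \<and> (Y, b) \<in> germ X x U t}"
    unfolding stalk_def by simp
  also have "{?g W a Y b | W a Y b. (W, a) \<in> germ X x U s \<and> (Y, b) \<in> germ X x U t}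
      = {germ X x U (s \<otimes>\<^bsub>Sec X U\<^esub> t)}" (is "?L = _")
  proof (intro equalityI subsetI)
    fix z assume "z \<in> ?L"
    then show "z \<in> {germ X x U (s \<otimes>\<^bsub>Sec X U\<^esub> t)}" using eq by auto
  next
    fix z assume "z \<in> {germ X x U (s \<otimes>\<^bsub>Sec X U\<^esub> t)}"
    then have "z = ?g U s U t"
      using eq[OF germ_self[OF U s] germ_self[OF U t]] by simp
    then show "z \<in> ?L"
      using germ_self[OF U s] germ_self[OF U t] by blast
  qed
  finally show ?thesis by simp
qed

lemma germ_pow:
  assumes X: "ringed_space X" and U: "is_open X U" "x \<in> U" and s: "s \<in> carrier (Sec X U)"
  shows "germ X x U (s [^]\<^bsub>Sec X U\<^esub> (n::nat)) = germ X x U s [^]\<^bsub>stalk X x\<^esub> n"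
proof (induction n)
  case 0
  interpret SU: cring "Sec X U" using cring_Sec[OF X] U by blast
  have P: "is_open X (points X)" "U \<subseteq> points X"
    using U openin_subset by auto
  interpret SP: cring "Sec X (points X)" using cring_Sec[OF X] P by blast
  have "germ X x U \<one>\<^bsub>Sec X U\<^esub> = germ X x (points X) \<one>\<^bsub>Sec X (points X)\<^esub>"
    using U P Res_self[OF X U(1)] ring_hom_one[OF Res_hom[OF X P(1) U(1) P(2)]]
    by (intro germ_eqI[OF X U(1) P(1) U(1)]) auto
  then show ?case by (simp add: stalk_def nat_pow_def)
next
  case (Suc n)
  interpret SU: cring "Sec X U" using cring_Sec[OF X] U by blast
  show ?case
    using germ_mult[OF X U SU.nat_pow_closed[OF s] s, of n] Suc by (simp add: nat_pow_def)
qed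

text \<open>
  This is why \<open>s\<close> and \<open>s\<^sup>m\<close> have the same nonvanishing locus: in the commutative monoid of a stalk, a
  factor of a unit is a unit.
\<close>

lemma germ_pow_Units_iff:
  assumes X: "locally_ringed_space X" and U: "is_open X U" "x \<in> U" and s: "s \<in> carrier (Sec X U)"
    and "0 < n"
  shows "germ X x U (s [^]\<^bsub>Sec X U\<^esub> (n::nat)) \<in> Units (stalk X x) \<longleftrightarrow> germ X x U s \<in> Units (stalk X x)"
proof -
  have R: "ringed_space X" using X unfolding locally_ringed_space_def by blast
  have "x \<in> points X" using U openin_subset by blast
  then have "cring (stalk X x)"
    using X unfolding locally_ringed_space_def local_ring_def by blast
  then interpret cring "stalk X x" .
  have "germ X x U s \<in> carrier (stalk X x)"
    unfolding stalk_def using U s by auto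
  then show ?thesis
    using Units_nat_pow_iff \<open>0 < n\<close> germ_pow[OF R U s] by simp
qed

section \<open>Line bundles with the same values on the space\<close>

text \<open>
  The functions in a \<open>line_bundle\<close> also have values at arguments outside the space; bundles
  that differ only there have the same sections.
\<close>

definition same_bundle :: "('p, 'r) rspace \<Rightarrow> ('p, 'r) line_bundle \<Rightarrow> ('p, 'r) line_bundle \<Rightarrow> bool" where
  "same_bundle X L L' \<longleftrightarrow> (\<forall>x \<in> points X. nbd L x = nbd L' x \<and>
     (\<forall>y \<in> points X. tfun L x y = tfun L' x y))"

lemma same_bundle_sym: "same_bundle X L L' \<Longrightarrow> same_bundle X L' L"
  unfolding same_bundle_def by simp

lemma same_bundle_trans [trans]: "same_bundle X L L' \<Longrightarrow> same_bundle X L' L'' \<Longrightarrow> same_bundle X L L''"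
  unfolding same_bundle_def by simp

lemma same_bundle_tensor:
  "same_bundle X L L' \<Longrightarrow> same_bundle X M M' \<Longrightarrow> same_bundle X (lb_tensor X L M) (lb_tensor X L' M')"
  unfolding same_bundle_def lb_tensor_def by (simp add: Let_def)

lemma same_bundle_power: "same_bundle X L L' \<Longrightarrow> same_bundle X (lb_power X L n) (lb_power X L' n)"
  unfolding same_bundle_def lb_power_def by simp

lemma is_line_bundle_cong: "same_bundle X L L' \<Longrightarrow> is_line_bundle X L = is_line_bundle X L'"
  unfolding same_bundle_def is_line_bundle_def by (simp cong: ball_cong)

lemma lb_sheaf_cong:
  assumes "same_bundle X L L'"
  shows "lb_sheaf X L = lb_sheaf X L'"
proof -
  have n: "nbd L x = nbd L' x" if "x \<in> points X" for x
    using assms that unfolding same_bundle_def by blast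
  have t: "tfun L x y = tfun L' x y" if "x \<in> points X" "y \<in> points X" for x y
    using assms that unfolding same_bundle_def by blast
  show ?thesis
    unfolding lb_sheaf_def Let_def by (simp add: n t cong: ball_cong restrict_cong)
qed

lemma nonvanishing_cong: "same_bundle X L L' \<Longrightarrow> nonvanishing X L s = nonvanishing X L' s"
  unfolding same_bundle_def nonvanishing_def by auto

lemma ample_cong:
  assumes "same_bundle X L L'"
  shows "ample X L = ample X L'"
  unfolding ample_def is_line_bundle_cong[OF assms]
    lb_sheaf_cong[OF same_bundle_power[OF assms]] nonvanishing_cong[OF same_bundle_power[OF assms]] ..

lemma same_bundle_restrict:
  "same_bundle X L L' \<Longrightarrow> same_bundle (open_sub X W) (lb_restrict X L W) (lb_restrict X L' W)"
  unfolding same_bundle_def open_sub_def lb_restrict_def by simp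

lemma relatively_ample_cong:
  assumes "same_bundle (src f) L L'"
  shows "relatively_ample f L = relatively_ample f L'"
  unfolding relatively_ample_def is_line_bundle_cong[OF assms]
    ample_cong[OF same_bundle_restrict[OF assms]] ..


section \<open>Powers of ample line bundles\<close>

text \<open>
  What ring laws for transition functions rely on.  It passes to powers, tensor products and
  pullbacks, so that bundles built in this way can be compared by computation.
\<close>

definition transition_data :: "('p, 'r) rspace \<Rightarrow> ('p, 'r) line_bundle \<Rightarrow> bool" where
  "transition_data X L \<longleftrightarrow> (\<forall>x \<in> points X. is_open X (nbd L x) \<and>
     (\<forall>y \<in> points X. tfun L x y \<in> carrier (Sec X (nbd L x \<inter> nbd L y))))"

lemma transition_dataD:
  assumes "transition_data X L" and "x \<in> points X"
  shows "is_open X (nbd L x)"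
    and "y \<in> points X \<Longrightarrow> is_open X (nbd L x \<inter> nbd L y)"
    and "y \<in> points X \<Longrightarrow> tfun L x y \<in> carrier (Sec X (nbd L x \<inter> nbd L y))"
  using assms unfolding transition_data_def by auto

lemma transition_data_line_bundle: "is_line_bundle X L \<Longrightarrow> transition_data X L"
  unfolding transition_data_def is_line_bundle_def Units_def by auto

lemma transition_data_power:
  assumes "ringed_space X" and "transition_data X L"
  shows "transition_data X (lb_power X L n)"
  unfolding transition_data_def
proof (intro ballI conjI)
  fix x y assume xy: "x \<in> points X" "y \<in> points X"
  interpret cring "Sec X (nbd L x \<inter> nbd L y)"
    using cring_Sec[OF assms(1)] transition_dataD(2)[OF assms(2)] xy .
  show "tfun (lb_power X L n) x y \<in> carrier (Sec X (nbd (lb_power X L n) x \<inter> nbd (lb_power X L n) y))"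
    unfolding lb_power_def using transition_dataD(3)[OF assms(2)] xy by simp
qed (use transition_dataD(1)[OF assms(2)] in \<open>simp add: lb_power_def\<close>)

lemma is_line_bundle_power:
  assumes X: "ringed_space X" and L: "is_line_bundle X L"
  shows "is_line_bundle X (lb_power X L n)"
  unfolding is_line_bundle_def
proof (intro ballI conjI)
  fix x assume "x \<in> points X"
  then show "is_open X (nbd (lb_power X L n) x)" "x \<in> nbd (lb_power X L n) x"
    using L unfolding is_line_bundle_def lb_power_def by auto
next
  fix x y assume xy: "x \<in> points X" "y \<in> points X"
  have "is_open X (nbd L x \<inter> nbd L y)" and u: "tfun L x y \<in> Units (Sec X (nbd L x \<inter> nbd L y))"
    using L xy unfolding is_line_bundle_def by auto
  then interpret cring "Sec X (nbd L x \<inter> nbd L y)"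
    using cring_Sec[OF X] by blast
  have "tfun L x y [^]\<^bsub>Sec X (nbd L x \<inter> nbd L y)\<^esub> n \<in> Units (Sec X (nbd L x \<inter> nbd L y))"
    using u by (induction n) auto
  then show "tfun (lb_power X L n) x y \<in> Units (Sec X (nbd (lb_power X L n) x \<inter> nbd (lb_power X L n) y))"
    unfolding lb_power_def by simp
next
  fix x y z assume xyz: "x \<in> points X" "y \<in> points X" "z \<in> points X"
  define D where "D = nbd L x \<inter> nbd L y \<inter> nbd L z"
  note T = transition_dataD[OF transition_data_line_bundle[OF L]]
  have D: "is_open X D" "D \<subseteq> nbd L x \<inter> nbd L y" "D \<subseteq> nbd L y \<inter> nbd L z" "D \<subseteq> nbd L x \<inter> nbd L z"
    unfolding D_def using T(1) xyz by auto
  interpret cring "Sec X D" using cring_Sec[OF X D(1)] .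
  have cocycle: "Res X (nbd L x \<inter> nbd L z) D (tfun L x z) =
      Res X (nbd L x \<inter> nbd L y) D (tfun L x y) \<otimes>\<^bsub>Sec X D\<^esub> Res X (nbd L y \<inter> nbd L z) D (tfun L y z)"
    using L xyz unfolding is_line_bundle_def D_def Let_def by blast
  have "Res X (nbd L x \<inter> nbd L z) D (tfun L x z [^]\<^bsub>Sec X (nbd L x \<inter> nbd L z)\<^esub> n) =
      Res X (nbd L x \<inter> nbd L y) D (tfun L x y [^]\<^bsub>Sec X (nbd L x \<inter> nbd L y)\<^esub> n) \<otimes>\<^bsub>Sec X D\<^esub>
      Res X (nbd L y \<inter> nbd L z) D (tfun L y z [^]\<^bsub>Sec X (nbd L y \<inter> nbd L z)\<^esub> n)"
    using xyz T D cocycle Res_closed[OF X]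
    by (simp add: Res_pow[OF X] nat_pow_distrib)
  then show "let D = nbd (lb_power X L n) x \<inter> nbd (lb_power X L n) y \<inter> nbd (lb_power X L n) z in
      Res X (nbd (lb_power X L n) x \<inter> nbd (lb_power X L n) z) D (tfun (lb_power X L n) x z) =
      Res X (nbd (lb_power X L n) x \<inter> nbd (lb_power X L n) y) D (tfun (lb_power X L n) x y) \<otimes>\<^bsub>Sec X D\<^esub>
      Res X (nbd (lb_power X L n) y \<inter> nbd (lb_power X L n) z) D (tfun (lb_power X L n) y z)"
    unfolding D_def Let_def lb_power_def by simp
qed

lemma same_bundle_power_power:
  assumes "ringed_space X" and "transition_data X L"
  shows "same_bundle X (lb_power X (lb_power X L m) n) (lb_power X L (m * n))"
  unfolding same_bundle_def
proof (intro ballI conjI)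
  fix x y assume xy: "x \<in> points X" "y \<in> points X"
  interpret cring "Sec X (nbd L x \<inter> nbd L y)"
    using cring_Sec[OF assms(1)] transition_dataD(2)[OF assms(2)] xy .
  show "tfun (lb_power X (lb_power X L m) n) x y = tfun (lb_power X L (m * n)) x y"
    unfolding lb_power_def using nat_pow_pow transition_dataD(3)[OF assms(2)] xy by simp
qed (simp add: lb_power_def)

lemma ringed_space_ample: "ample X L \<Longrightarrow> ringed_space X"
  unfolding ample_def scheme_def locally_ringed_space_def by blast

definition section_power :: "('p, 'r) rspace \<Rightarrow> ('p, 'r) line_bundle \<Rightarrow> ('p \<Rightarrow> 'r) \<Rightarrow> nat \<Rightarrow> 'p \<Rightarrow> 'r" where
  "section_power X L s m = (\<lambda>x\<in>points X. s x [^]\<^bsub>Sec X (nbd L x)\<^esub> m)"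

lemma section_power_global:
  assumes X: "ringed_space X" and L: "transition_data X L" and s: "s \<in> global_sections X L"
  shows "section_power X L s m \<in> global_sections X (lb_power X L m)"
proof -
  note T = transition_dataD[OF L]
  have pn: "points X \<inter> nbd L x = nbd L x" if "x \<in> points X" for x
    using openin_subset[OF T(1)[OF that]] by auto
  have sx: "s x \<in> carrier (Sec X (nbd L x))" if "x \<in> points X" for x
    using s pn that unfolding lb_sheaf_def by auto
  have glue: "Res X (nbd L x) (nbd L x \<inter> nbd L y) (s x) =
      Res X (nbd L x \<inter> nbd L y) (nbd L x \<inter> nbd L y) (tfun L x y) \<otimes>\<^bsub>Sec X (nbd L x \<inter> nbd L y)\<^esub>
      Res X (nbd L y) (nbd L x \<inter> nbd L y) (s y)"
    if "x \<in> points X" "y \<in> points X" for x y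
    using s pn that unfolding lb_sheaf_def Let_def by (auto simp flip: Int_assoc)
  have c: "s x [^]\<^bsub>Sec X (nbd L x)\<^esub> m \<in> carrier (Sec X (nbd L x))" if x: "x \<in> points X" for x
  proof -
    interpret cring "Sec X (nbd L x)" using cring_Sec[OF X T(1)[OF x]] .
    show ?thesis using sx[OF x] by simp
  qed
  have g: "Res X (nbd L x) (nbd L x \<inter> nbd L y) (s x [^]\<^bsub>Sec X (nbd L x)\<^esub> m) =
      Res X (nbd L x \<inter> nbd L y) (nbd L x \<inter> nbd L y) (tfun L x y [^]\<^bsub>Sec X (nbd L x \<inter> nbd L y)\<^esub> m)
        \<otimes>\<^bsub>Sec X (nbd L x \<inter> nbd L y)\<^esub>
      Res X (nbd L y) (nbd L x \<inter> nbd L y) (s y [^]\<^bsub>Sec X (nbd L y)\<^esub> m)"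
    if xy: "x \<in> points X" "y \<in> points X" for x y
  proof -
    interpret cring "Sec X (nbd L x \<inter> nbd L y)" using cring_Sec[OF X T(2)] xy by blast
    show ?thesis
      using xy T sx Res_closed[OF X] glue[OF xy] by (simp add: Res_pow[OF X] nat_pow_distrib)
  qed
  show ?thesis
    using c g pn unfolding lb_sheaf_def Let_def section_power_def lb_power_def
    by (auto simp flip: Int_assoc)
qed

lemma nonvanishing_section_power:
  assumes X: "locally_ringed_space X" and L: "is_line_bundle X L" and s: "s \<in> global_sections X L"
    and "0 < m"
  shows "nonvanishing X (lb_power X L m) (section_power X L s m) = nonvanishing X L s"
proof -
  have "germ X x (nbd L x) (s x [^]\<^bsub>Sec X (nbd L x)\<^esub> m) \<in> Units (stalk X x) \<longleftrightarrow>
      germ X x (nbd L x) (s x) \<in> Units (stalk X x)" if x: "x \<in> points X" for x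
  proof (rule germ_pow_Units_iff[OF X _ _ _ \<open>0 < m\<close>])
    show op: "is_open X (nbd L x)" and "x \<in> nbd L x"
      using L x unfolding is_line_bundle_def by auto
    have "points X \<inter> nbd L x = nbd L x" using openin_subset[OF op] by auto
    then show "s x \<in> carrier (Sec X (nbd L x))"
      using s x unfolding lb_sheaf_def by auto
  qed
  then show ?thesis
    unfolding nonvanishing_def section_power_def lb_power_def by auto
qed

text \<open>
  If \<open>s\<close> is a section of \<open>L\<^sup>n\<close> with affine nonvanishing locus, then \<open>s\<^sup>m\<close> is a section of
  \<open>(L\<^sup>m)\<^sup>n\<close> with the same nonvanishing locus.
\<close>

lemma ample_power:
  assumes ample: "ample X L" and m: "0 < m"
  shows "ample X (lb_power X L m)"
proof -
  have S: "scheme X" and K: "compact_space (rtop X)" and L: "is_line_bundle X L"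
    and cover: "\<And>x. x \<in> points X \<Longrightarrow> \<exists>n\<ge>1. \<exists>s \<in> global_sections X (lb_power X L n).
        x \<in> nonvanishing X (lb_power X L n) s \<and> affine_open X (nonvanishing X (lb_power X L n) s)"
    using ample unfolding ample_def by blast+
  have lrs: "locally_ringed_space X" using S unfolding scheme_def by blast
  have X: "ringed_space X" using ringed_space_ample[OF ample] .
  have "\<exists>n\<ge>1. \<exists>s \<in> global_sections X (lb_power X (lb_power X L m) n).
      x \<in> nonvanishing X (lb_power X (lb_power X L m) n) s \<and>
      affine_open X (nonvanishing X (lb_power X (lb_power X L m) n) s)" if x_in: "x \<in> points X" for x
  proof -
    obtain n s where n: "n \<ge> 1" and s: "s \<in> global_sections X (lb_power X L n)"
      and x: "x \<in> nonvanishing X (lb_power X L n) s"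
      and aff: "affine_open X (nonvanishing X (lb_power X L n) s)"
      using cover[OF x_in] by blast
    let ?s = "section_power X (lb_power X L n) s m"
    note T = transition_data_line_bundle[OF L]
    have sb: "same_bundle X (lb_power X (lb_power X L n) m) (lb_power X (lb_power X L m) n)"
      using same_bundle_power_power[OF X T, of n m]
        same_bundle_sym[OF same_bundle_power_power[OF X T, of m n]]
      by (auto intro: same_bundle_trans simp: mult.commute)
    have nv: "nonvanishing X (lb_power X (lb_power X L m) n) ?s = nonvanishing X (lb_power X L n) s"
      using nonvanishing_section_power[OF lrs is_line_bundle_power[OF X L] s m]
        nonvanishing_cong[OF sb] by metis
    have "?s \<in> global_sections X (lb_power X (lb_power X L m) n)"
      using section_power_global[OF X transition_data_power[OF X T] s, of m] lb_sheaf_cong[OF sb] by metis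
    then show ?thesis using n x aff nv by metis
  qed
  then show ?thesis
    unfolding ample_def using S K is_line_bundle_power[OF X L] by blast
qed

lemma same_bundle_restrict_power:
  assumes X: "ringed_space X" and L: "transition_data X L" and W: "is_open X W"
  shows "same_bundle (open_sub X W) (lb_power (open_sub X W) (lb_restrict X L W) m)
    (lb_restrict X (lb_power X L m) W)"
proof -
  have eq: "(nbd L x \<inter> W) \<inter> (nbd L y \<inter> W) = nbd L x \<inter> nbd L y \<inter> W" for x y by auto
  have "Res X (nbd L x \<inter> nbd L y) (nbd L x \<inter> nbd L y \<inter> W) (tfun L x y)
        [^]\<^bsub>Sec X (nbd L x \<inter> nbd L y \<inter> W)\<^esub> m =
      Res X (nbd L x \<inter> nbd L y) (nbd L x \<inter> nbd L y \<inter> W) (tfun L x y [^]\<^bsub>Sec X (nbd L x \<inter> nbd L y)\<^esub> m)"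
    if "x \<in> points X" "y \<in> points X" for x y
    using Res_pow[OF X _ _ _ transition_dataD(3)[OF L that]] transition_dataD(2)[OF L that] W
    by (metis Int_lower1 openin_Int)
  then show ?thesis
    unfolding same_bundle_def by (simp add: open_sub_def lb_power_def lb_restrict_def eq)
qed

lemma relatively_ample_power:
  assumes f: "f \<in> Mor (src f) (tgt f)" and ample: "relatively_ample f L" and m: "0 < m"
  shows "relatively_ample f (lb_power (src f) L m)"
proof -
  have X: "ringed_space (src f)"
    using f unfolding Mor_def morphism_def locally_ringed_space_def by blast
  have L: "is_line_bundle (src f) L" using ample unfolding relatively_ample_def by blast
  have "ample (open_sub (src f) (preim f W)) (lb_restrict (src f) (lb_power (src f) L m) (preim f W))"
    if W: "affine_open (tgt f) W" for W
  proof -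
    have cont: "continuous_map (rtop (src f)) (rtop (tgt f)) (pmap f)"
      using f unfolding Mor_def morphism_def by blast
    have "is_open (src f) (preim f W)"
      using openin_continuous_map_preimage[OF cont] W unfolding affine_open_def preim_def by blast
    note sb = same_bundle_restrict_power[OF X transition_data_line_bundle[OF L] this, of m]
    have "ample (open_sub (src f) (preim f W)) (lb_restrict (src f) L (preim f W))"
      using ample W unfolding relatively_ample_def by blast
    from ample_power[OF this m] show ?thesis using ample_cong[OF sb] by blast
  qed
  then show ?thesis
    unfolding relatively_ample_def using is_line_bundle_power[OF X L] by blast
qed


section \<open>Tensor products of line bundles\<close>

lemma transition_data_tensor:
  assumes X: "ringed_space X" and L: "transition_data X L" and M: "transition_data X M"
  shows "transition_data X (lb_tensor X L M)"
  unfolding transition_data_def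
proof (intro ballI conjI)
  fix x assume x: "x \<in> points X"
  show "is_open X (nbd (lb_tensor X L M) x)"
    using transition_dataD(1)[OF L x] transition_dataD(1)[OF M x] unfolding lb_tensor_def by auto
  fix y assume y: "y \<in> points X"
  define D where "D = (nbd L x \<inter> nbd M x) \<inter> (nbd L y \<inter> nbd M y)"
  have D: "is_open X D" "D \<subseteq> nbd L x \<inter> nbd L y" "D \<subseteq> nbd M x \<inter> nbd M y"
    unfolding D_def using transition_dataD(1)[OF L] transition_dataD(1)[OF M] x y by auto
  interpret cring "Sec X D" using cring_Sec[OF X D(1)] .
  show "tfun (lb_tensor X L M) x y \<in> carrier (Sec X (nbd (lb_tensor X L M) x \<inter> nbd (lb_tensor X L M) y))"
    unfolding lb_tensor_def Let_def
    using Res_closed[OF X _ D(1,2)] Res_closed[OF X _ D(1,3)]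
      transition_dataD[OF L x] transition_dataD[OF M x] y
    by (simp flip: D_def)
qed

lemma same_bundle_tensor_power:
  assumes X: "ringed_space X" and L: "transition_data X L" and M: "transition_data X M"
  shows "same_bundle X (lb_power X (lb_tensor X L M) m) (lb_tensor X (lb_power X L m) (lb_power X M m))"
  unfolding same_bundle_def
proof (intro ballI conjI)
  fix x y assume x: "x \<in> points X" and y: "y \<in> points X"
  define D where "D = (nbd L x \<inter> nbd M x) \<inter> (nbd L y \<inter> nbd M y)"
  have D: "is_open X D" "D \<subseteq> nbd L x \<inter> nbd L y" "D \<subseteq> nbd M x \<inter> nbd M y"
    unfolding D_def using transition_dataD(1)[OF L] transition_dataD(1)[OF M] x y by auto
  interpret cring "Sec X D" using cring_Sec[OF X D(1)] .
  show "tfun (lb_power X (lb_tensor X L M) m) x y = tfun (lb_tensor X (lb_power X L m) (lb_power X M m)) x y"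
    unfolding lb_tensor_def lb_power_def Let_def
    using Res_closed[OF X _ D(1,2)] Res_closed[OF X _ D(1,3)] Res_pow[OF X _ D(1,2)] Res_pow[OF X _ D(1,3)]
      transition_dataD[OF L x] transition_dataD[OF M x] y
    by (simp add: nat_pow_distrib flip: D_def)
qed (simp add: lb_power_def lb_tensor_def)

lemma transition_data_pullback:
  assumes f: "f \<in> Mor X Y" and L: "transition_data Y L"
  shows "transition_data X (lb_pullback f L)"
  unfolding transition_data_def
proof (intro ballI conjI)
  have m: "morphism f" and src: "src f = X" and tgt: "tgt f = Y"
    using f unfolding Mor_def by auto
  have cont: "continuous_map (rtop X) (rtop Y) (pmap f)"
    using m src tgt unfolding morphism_def by auto
  fix x assume "x \<in> points X"
  then have x: "pmap f x \<in> points Y"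
    using continuous_map_image_subset_topspace[OF cont] by auto
  show "is_open X (nbd (lb_pullback f L) x)"
    using openin_continuous_map_preimage[OF cont transition_dataD(1)[OF L x]]
    by (simp add: lb_pullback_def preim_def src)
  fix y assume "y \<in> points X"
  then have y: "pmap f y \<in> points Y"
    using continuous_map_image_subset_topspace[OF cont] by auto
  let ?U = "nbd L (pmap f x) \<inter> nbd L (pmap f y)"
  have "cmap f ?U \<in> ring_hom (Sec Y ?U) (Sec X (preim f ?U))"
    using m[unfolded morphism_def src tgt] transition_dataD(2)[OF L x y] by simp
  moreover have "preim f ?U = preim f (nbd L (pmap f x)) \<inter> preim f (nbd L (pmap f y))"
    unfolding preim_def by auto
  ultimately show "tfun (lb_pullback f L) x y \<in>
      carrier (Sec X (nbd (lb_pullback f L) x \<inter> nbd (lb_pullback f L) y))"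
    unfolding lb_pullback_def using ring_hom_closed transition_dataD(3)[OF L x y] by fastforce
qed

definition common_nbd :: "('p, 'r) rspace \<Rightarrow> 'i set \<Rightarrow> ('i \<Rightarrow> ('p, 'r) line_bundle) \<Rightarrow> 'p \<Rightarrow> 'p set" where
  "common_nbd X I L = (\<lambda>x. points X \<inter> (\<Inter>i\<in>I. nbd (L i) x))"

lemma lb_product_eq:
  "lb_product X I L n =
    \<lparr> nbd = common_nbd X I L,
      tfun = (\<lambda>x y. let D = common_nbd X I L x \<inter> common_nbd X I L y in
        finprod (Sec X D) (\<lambda>i. Res X (nbd (L i) x \<inter> nbd (L i) y) D (tfun (L i) x y) [^]\<^bsub>Sec X D\<^esub> n i) I) \<rparr>"
  by (simp add: lb_product_def common_nbd_def Let_def)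

lemma is_open_common_nbd:
  assumes "finite I" and "\<And>i. i \<in> I \<Longrightarrow> transition_data X (L i)" and "x \<in> points X"
  shows "is_open X (common_nbd X I L x)"
  using assms(1,2) unfolding common_nbd_def
proof (induction I)
  case (insert i I)
  have "is_open X (nbd (L i) x \<inter> (points X \<inter> (\<Inter>i\<in>I. nbd (L i) x)))"
    using insert transition_dataD(1)[OF insert.prems[of i] assms(3)] by blast
  then show ?case by (simp add: Int_left_commute)
qed simp

lemma Res_common_nbd_closed:
  assumes X: "ringed_space X" and I: "finite I" and L: "\<And>i. i \<in> I \<Longrightarrow> transition_data X (L i)"
    and x: "x \<in> points X" and y: "y \<in> points X" and i: "i \<in> I"
  shows "Res X (nbd (L i) x \<inter> nbd (L i) y) (common_nbd X I L x \<inter> common_nbd X I L y) (tfun (L i) x y)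
    \<in> carrier (Sec X (common_nbd X I L x \<inter> common_nbd X I L y))"
proof -
  have "common_nbd X I L x \<inter> common_nbd X I L y \<subseteq> nbd (L i) x \<inter> nbd (L i) y"
    using i unfolding common_nbd_def by blast
  moreover have "is_open X (common_nbd X I L x \<inter> common_nbd X I L y)"
    using is_open_common_nbd[where L = L, OF I L] x y by blast
  ultimately show ?thesis
    using Res_closed[OF X] transition_dataD[OF L[OF i] x] y by blast
qed

lemma transition_data_product:
  assumes X: "ringed_space X" and I: "finite I" and L: "\<And>i. i \<in> I \<Longrightarrow> transition_data X (L i)"
  shows "transition_data X (lb_product X I L n)"
  unfolding transition_data_def
proof (intro ballI conjI)
  fix x assume x: "x \<in> points X"
  show "is_open X (nbd (lb_product X I L n) x)"
    unfolding lb_product_eq using is_open_common_nbd[where L = L, OF I L x] by simp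
  fix y assume y: "y \<in> points X"
  interpret cring "Sec X (common_nbd X I L x \<inter> common_nbd X I L y)"
    using cring_Sec[OF X] is_open_common_nbd[where L = L, OF I L] x y by blast
  show "tfun (lb_product X I L n) x y \<in>
      carrier (Sec X (nbd (lb_product X I L n) x \<inter> nbd (lb_product X I L n) y))"
    unfolding lb_product_eq Let_def using Res_common_nbd_closed[where L = L, OF X I L x y]
    by (simp add: Pi_iff)
qed

lemma same_bundle_product_power:
  assumes X: "ringed_space X" and I: "finite I" and L: "\<And>i. i \<in> I \<Longrightarrow> transition_data X (L i)"
  shows "same_bundle X (lb_power X (lb_product X I L n) m) (lb_product X I L (\<lambda>i. n i * m))"
  unfolding same_bundle_def
proof (intro ballI conjI)
  fix x y assume x: "x \<in> points X" and y: "y \<in> points X"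
  define D where "D = common_nbd X I L x \<inter> common_nbd X I L y"
  interpret cring "Sec X D"
    using cring_Sec[OF X] is_open_common_nbd[where L = L, OF I L] x y unfolding D_def by blast
  define t where "t = (\<lambda>i. Res X (nbd (L i) x \<inter> nbd (L i) y) D (tfun (L i) x y))"
  have t: "t i \<in> carrier (Sec X D)" if "i \<in> I" for i
    using Res_common_nbd_closed[where L = L, OF X I L x y that] unfolding t_def D_def .
  have "finprod (Sec X D) (\<lambda>i. t i [^]\<^bsub>Sec X D\<^esub> n i) I [^]\<^bsub>Sec X D\<^esub> m =
      finprod (Sec X D) (\<lambda>i. (t i [^]\<^bsub>Sec X D\<^esub> n i) [^]\<^bsub>Sec X D\<^esub> m) I"
    using t I by (intro finprod_nat_pow) auto
  also have "\<dots> = finprod (Sec X D) (\<lambda>i. t i [^]\<^bsub>Sec X D\<^esub> (n i * m)) I"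
    using t by (intro finprod_cong') (auto simp: nat_pow_pow)
  finally show "tfun (lb_power X (lb_product X I L n) m) x y = tfun (lb_product X I L (\<lambda>i. n i * m)) x y"
    unfolding lb_product_eq lb_power_def Let_def t_def D_def by simp
qed (simp add: lb_power_def lb_product_eq)

text \<open>
  Equal factors of a product can be collected: on the fibre over \<open>i\<close> all factors are powers of the
  transition function of \<open>L i\<close>, and their exponents add up.  The neighbourhoods on both sides
  coincide since both are intersections over the same set of bundles.
\<close>

lemma same_bundle_product_fibres:
  assumes X: "ringed_space X" and J: "finite J" and L: "\<And>i. i \<in> \<phi> ` J \<Longrightarrow> transition_data X (L i)"
    and n: "\<And>i. i \<in> \<phi> ` J \<Longrightarrow> n i = (\<Sum>j | j \<in> J \<and> \<phi> j = i. n' j)"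
  shows "same_bundle X (lb_product X (\<phi> ` J) L n) (lb_product X J (\<lambda>j. L (\<phi> j)) n')"
proof -
  have nbd: "common_nbd X J (\<lambda>j. L (\<phi> j)) = common_nbd X (\<phi> ` J) L"
    unfolding common_nbd_def by auto
  have "finprod (Sec X D) (\<lambda>i. t i [^]\<^bsub>Sec X D\<^esub> n i) (\<phi> ` J) =
      finprod (Sec X D) (\<lambda>j. t (\<phi> j) [^]\<^bsub>Sec X D\<^esub> n' j) J"
    if "x \<in> points X" "y \<in> points X" and D: "D = common_nbd X (\<phi> ` J) L x \<inter> common_nbd X (\<phi> ` J) L y"
      and t_def: "t = (\<lambda>i. Res X (nbd (L i) x \<inter> nbd (L i) y) D (tfun (L i) x y))" for x y D t
  proof -
    have J': "finite (\<phi> ` J)" using J by simp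
    interpret cring "Sec X D"
      using cring_Sec[OF X] is_open_common_nbd[where L = L, OF J' L] that(1,2) unfolding D by blast
    have t: "t i \<in> carrier (Sec X D)" if "i \<in> \<phi> ` J" for i
      using Res_common_nbd_closed[where L = L, OF X J' L \<open>x \<in> points X\<close> \<open>y \<in> points X\<close> that] unfolding t_def D .
    have fibre: "finprod (Sec X D) (\<lambda>j. t (\<phi> j) [^]\<^bsub>Sec X D\<^esub> n' j) {j \<in> J. \<phi> j = i} = t i [^]\<^bsub>Sec X D\<^esub> n i"
      if i: "i \<in> \<phi> ` J" for i
    proof -
      have "finprod (Sec X D) (\<lambda>j. t (\<phi> j) [^]\<^bsub>Sec X D\<^esub> n' j) {j \<in> J. \<phi> j = i} =
          finprod (Sec X D) (\<lambda>j. t i [^]\<^bsub>Sec X D\<^esub> n' j) {j \<in> J. \<phi> j = i}"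
        using t[OF i] by (intro finprod_cong') auto
      also have "\<dots> = t i [^]\<^bsub>Sec X D\<^esub> n i"
        using finprod_const_base[of "{j \<in> J. \<phi> j = i}", OF _ t[OF i], of n'] J unfolding n[OF i] by simp
      finally show ?thesis .
    qed
    have "finprod (Sec X D) (\<lambda>j. t (\<phi> j) [^]\<^bsub>Sec X D\<^esub> n' j) J =
        finprod (Sec X D) (\<lambda>i. finprod (Sec X D) (\<lambda>j. t (\<phi> j) [^]\<^bsub>Sec X D\<^esub> n' j) {j \<in> J. \<phi> j = i}) (\<phi> ` J)"
      using t J by (intro finprod_over_fibres) auto
    also have "\<dots> = finprod (Sec X D) (\<lambda>i. t i [^]\<^bsub>Sec X D\<^esub> n i) (\<phi> ` J)"
      using t fibre by (intro finprod_cong') auto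
    finally show ?thesis ..
  qed
  then show ?thesis
    unfolding same_bundle_def lb_product_eq Let_def nbd by simp
qed

section \<open>Pulling back sections along a map of label sets\<close>

definition relabel_sections ::
    "('i \<Rightarrow> 'j) \<Rightarrow> 'i set \<Rightarrow> ('j, 't, 'a, 'c, 'b, 'v, 'r, 'k) family \<Rightarrow>
     ('i, 't, 'a, 'c, 'b, 'v, 'r, 'k) family" where
  "relabel_sections \<phi> S X =
    \<lparr> base = base X, curve = curve X, sect = (\<lambda>i\<in>S. sect X (\<phi> i)), emap = emap X \<rparr>"

text \<open>
  \<open>B\<close> is the pushforward of \<open>A\<close> along \<open>\<phi>\<close>, as for measures.
\<close>

definition fibre_sum_weights ::
    "('i \<Rightarrow> 'j) \<Rightarrow> 'i set \<Rightarrow> ('i \<Rightarrow> rat) \<Rightarrow> 'j set \<Rightarrow> ('j \<Rightarrow> rat) \<Rightarrow> bool" where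
  "fibre_sum_weights \<phi> S A T B \<longleftrightarrow> finite S \<and> \<phi> ` S \<subseteq> T \<and> (\<forall>i\<in>S. 0 \<le> A i) \<and>
     (\<forall>j\<in>T. B j = (\<Sum>i | i \<in> S \<and> \<phi> i = j. A i))"

lemma weight_le_fibre_sum:
  assumes "fibre_sum_weights \<phi> S A T B" and "i \<in> S"
  shows "A i \<le> B (\<phi> i)"
proof -
  have "A i \<le> (\<Sum>i' | i' \<in> S \<and> \<phi> i' = \<phi> i. A i')"
    using assms unfolding fibre_sum_weights_def by (intro member_le_sum) auto
  then show ?thesis using assms unfolding fibre_sum_weights_def by auto
qed

lemma sum_weight_le_image:
  assumes W: "fibre_sum_weights \<phi> S A T B" and I: "I \<subseteq> S"
  shows "(\<Sum>i\<in>I. A i) \<le> (\<Sum>j\<in>\<phi> ` I. B j)"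
proof -
  have fin: "finite I" using W I finite_subset unfolding fibre_sum_weights_def by blast
  have "(\<Sum>i\<in>I. A i) = (\<Sum>j\<in>\<phi> ` I. \<Sum>i | i \<in> I \<and> \<phi> i = j. A i)"
    using sum.image_gen[OF fin] .
  also have "\<dots> \<le> (\<Sum>j\<in>\<phi> ` I. \<Sum>i | i \<in> S \<and> \<phi> i = j. A i)"
    using W I unfolding fibre_sum_weights_def by (intro sum_mono sum_mono2) auto
  also have "\<dots> = (\<Sum>j\<in>\<phi> ` I. B j)"
    using W I unfolding fibre_sum_weights_def
    by (intro sum.cong) (auto simp: subset_iff image_subset_iff)
  finally show ?thesis .
qed

text \<open>
  Only labels of positive weight contribute to the divisor.  A sum of nonnegative weights is positive
  iff one of them is, so \<open>\<phi>\<close> restricts to a surjection between the contributing labels, as is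
  needed to collect the factors of the product over \<open>S\<close> along \<open>\<phi>\<close>.
\<close>

lemma image_positive_weights:
  assumes W: "fibre_sum_weights \<phi> S A T B"
  shows "\<phi> ` {i \<in> S. A i > 0} = {j \<in> T. B j > 0}"
proof (intro equalityI subsetI)
  fix j assume "j \<in> \<phi> ` {i \<in> S. A i > 0}"
  then obtain i where "j = \<phi> i" "i \<in> S" "A i > 0" by auto
  then show "j \<in> {j \<in> T. B j > 0}"
    using weight_le_fibre_sum[OF W] W unfolding fibre_sum_weights_def by force
next
  fix j assume j: "j \<in> {j \<in> T. B j > 0}"
  then have "(\<Sum>i | i \<in> S \<and> \<phi> i = j. A i) > 0"
    using W unfolding fibre_sum_weights_def by auto
  then obtain i where "i \<in> S" "\<phi> i = j" "A i > 0"
    using sum_nonpos[of "{i. i \<in> S \<and> \<phi> i = j}" A] by (metis (mono_tags, lifting) mem_Collect_eq not_less)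
  then show "j \<in> \<phi> ` {i \<in> S. A i > 0}" by auto
qed

lemma common_denominator:
  fixes A :: "'i \<Rightarrow> rat"
  assumes "finite I" and "\<And>i. i \<in> I \<Longrightarrow> 0 \<le> A i"
  shows "\<exists>m>0. \<forall>i\<in>I. \<exists>n. of_nat n = of_nat m * A i"
  using assms
proof (induction I)
  case empty
  then show ?case by auto
next
  case (insert i I)
  then obtain m where m: "m > 0" "\<forall>i\<in>I. \<exists>n. of_nat n = of_nat m * A i" by auto
  obtain p q where pq: "A i = of_int p / of_int q" "q > 0"
    using quotient_of_div[of "A i"] quotient_of_denom_pos[of "A i"] by (metis surj_pair)
  have "p \<ge> 0" using insert.prems[of i] pq by (simp add: zero_le_divide_iff)
  then have q: "of_nat (nat p) = of_nat (nat q) * A i" using pq by (simp add: of_nat_nat)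
  have "\<exists>n. of_nat n = of_nat (m * nat q) * A i'" if i': "i' \<in> insert i I" for i'
  proof (cases "i' = i")
    case True
    then have "of_nat (m * nat p) = of_nat (m * nat q) * A i'" using q by simp
    then show ?thesis by blast
  next
    case False
    then obtain n where "of_nat n = of_nat m * A i'" using m i' by auto
    then have "of_nat (n * nat q) = of_nat (m * nat q) * A i'" by simp
    then show ?thesis by blast
  qed
  then show ?case using m(1) pq(2) by (intro exI[of _ "m * nat q"]) auto
qed

lemma prestable_map_relabel:
  assumes W: "fibre_sum_weights \<phi> S A T B" and X: "prestable_map k v g T B \<beta> X"
  shows "prestable_map k v g S A \<beta> (relabel_sections \<phi> S X)"
proof -
  have \<phi>: "\<phi> i \<in> T" if "i \<in> S" for i
    using W that unfolding fibre_sum_weights_def by auto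
  have pos: "B (\<phi> i) > 0" if "i \<in> S" "A i > 0" for i
    using weight_le_fibre_sum[OF W that(1)] that(2) by simp
  have "(\<Sum>i\<in>I. A i) \<le> 1"
    if I: "I \<subseteq> S" and meet: "points (src (curve X)) \<inter>
        (\<Inter>i\<in>I. pmap (sect (relabel_sections \<phi> S X) i) ` points (tgt (curve X))) \<noteq> {}" for I
  proof -
    have "(\<Inter>i\<in>I. pmap (sect (relabel_sections \<phi> S X) i) ` points (tgt (curve X))) =
        (\<Inter>j\<in>\<phi> ` I. pmap (sect X j) ` points (tgt (curve X)))"
      using I by (simp add: relabel_sections_def subset_iff)
    moreover have "\<phi> ` I \<subseteq> T" using \<phi> I by auto
    ultimately have "(\<Sum>j\<in>\<phi> ` I. B j) \<le> 1"
      using X meet unfolding prestable_map_def Let_def by metis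
    then show ?thesis using sum_weight_le_image[OF W I] by linarith
  qed
  then show ?thesis
    using X \<phi> pos unfolding prestable_map_def Let_def by (simp add: relabel_sections_def)
qed

text \<open>
  The given multiple \<open>N\<close> of the divisor is replaced by \<open>N m\<close>, where \<open>m\<close> clears the denominators of
  \<open>A\<close>; the label \<open>i\<close> gets the divisor bundle of \<open>\<phi> i\<close>.  The resulting bundle is the \<open>m\<close>-th power of
  the given one, hence relatively ample.
\<close>

lemma stable_map_relabel:
  assumes W: "fibre_sum_weights \<phi> S A T B" and X: "stable_map k v g T B \<beta> X"
  shows "stable_map k v g S A \<beta> (relabel_sections \<phi> S X)"
proof -
  define C where "C = src (curve X)"
  define P where "P = {i \<in> S. A i > 0}"
  define Q where "Q = {j \<in> T. B j > 0}"
  have PQ: "\<phi> ` P = Q" unfolding P_def Q_def using image_positive_weights[OF W] .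
  have finP: "finite P" using W unfolding P_def fibre_sum_weights_def by simp
  have pre: "prestable_map k v g T B \<beta> X" using X unfolding stable_map_def by blast
  obtain M N n \<omega> D where M: "ample (src v) M" and N: "N > 0"
    and n: "\<And>j. j \<in> Q \<Longrightarrow> of_nat (n j) = of_nat N * B j"
    and \<omega>: "relative_dualizing (curve X) \<omega>"
    and D: "\<And>j. j \<in> Q \<Longrightarrow> section_divisor_bundle (sect X j) (D j)"
    and amp: "relatively_ample (curve X)
        (lb_tensor C (lb_tensor C (lb_power C \<omega> N) (lb_product C Q D n))
          (lb_power C (lb_pullback (emap X) M) (3 * N)))"
    using X unfolding stable_map_def Let_def Q_def[symmetric] C_def[symmetric] by blast

  have \<pi>: "curve X \<in> Mor C (tgt (curve X))" and f: "emap X \<in> Mor C (src v)"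
    using pre unfolding prestable_map_def nodal_curve_def Let_def C_def by auto
  have C: "ringed_space C"
    using \<pi> unfolding Mor_def morphism_def locally_ringed_space_def by auto
  have T\<omega>: "transition_data C \<omega>"
    using \<omega> transition_data_line_bundle unfolding relative_dualizing_def C_def by blast
  have TD: "transition_data C (D j)" if j: "j \<in> Q" for j
  proof -
    have "sect X j \<in> Mor (tgt (curve X)) C"
      using pre j unfolding prestable_map_def Let_def Q_def C_def by blast
    then show ?thesis
      using D[OF j] transition_data_line_bundle unfolding section_divisor_bundle_def Mor_def Let_def by auto
  qed
  have Tf: "transition_data C (lb_pullback (emap X) M)"
    using M transition_data_pullback[OF f] transition_data_line_bundle unfolding ample_def by blast

  obtain m where m: "m > 0" and "\<forall>i\<in>P. \<exists>l. of_nat l = of_nat m * A i"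
    using common_denominator[OF finP, of A] unfolding P_def by auto
  then obtain l where l: "\<And>i. i \<in> P \<Longrightarrow> of_nat (l i) = of_nat m * A i" by metis
  define n' where "n' = (\<lambda>i. N * l i)"
  have n': "of_nat (n' i) = of_nat (N * m) * A i" if "i \<in> P" for i
    using l[OF that] unfolding n'_def by simp
  \<comment> \<open>Exponents are compared in the rationals, where both sides are \<open>N m B(j)\<close>.\<close>
  have fibre: "n j * m = (\<Sum>i | i \<in> P \<and> \<phi> i = j. n' i)" if j: "j \<in> Q" for j
  proof -
    have "(of_nat (n j * m) :: rat) = of_nat (N * m) * B j" using n[OF j] by simp
    also have "B j = (\<Sum>i | i \<in> S \<and> \<phi> i = j. A i)"
      using W j unfolding fibre_sum_weights_def Q_def by auto
    \<comment> \<open>Labels outside \<open>P\<close> have weight zero.\<close>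
    also have "\<dots> = (\<Sum>i | i \<in> P \<and> \<phi> i = j. A i)"
      using W unfolding fibre_sum_weights_def P_def
      by (intro sum.mono_neutral_right) (auto simp: order.order_iff_strict)
    also have "of_nat (N * m) * \<dots> = (\<Sum>i | i \<in> P \<and> \<phi> i = j. of_nat (n' i))"
      unfolding sum_distrib_left by (rule sum.cong) (simp_all add: n')
    also have "\<dots> = of_nat (\<Sum>i | i \<in> P \<and> \<phi> i = j. n' i)" by simp
    finally show ?thesis by (simp only: of_nat_eq_iff)
  qed

  have finQ: "finite Q" using finP PQ by blast
  have "same_bundle C (lb_power C (lb_product C Q D n) m) (lb_product C Q D (\<lambda>j. n j * m))"
    by (rule same_bundle_product_power[OF C finQ TD])
  also have "same_bundle C (lb_product C Q D (\<lambda>j. n j * m)) (lb_product C P (\<lambda>i. D (\<phi> i)) n')"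
    using same_bundle_product_fibres[OF C finP, of \<phi> D "\<lambda>j. n j * m" n'] TD fibre unfolding PQ by blast
  finally have prod: "same_bundle C (lb_power C (lb_product C Q D n) m) (lb_product C P (\<lambda>i. D (\<phi> i)) n')" .

  have "same_bundle C
      (lb_power C (lb_tensor C (lb_tensor C (lb_power C \<omega> N) (lb_product C Q D n))
        (lb_power C (lb_pullback (emap X) M) (3 * N))) m)
      (lb_tensor C (lb_power C (lb_tensor C (lb_power C \<omega> N) (lb_product C Q D n)) m)
        (lb_power C (lb_power C (lb_pullback (emap X) M) (3 * N)) m))"
    by (intro same_bundle_tensor_power C transition_data_tensor transition_data_power
        transition_data_product T\<omega> TD Tf finQ)
  also have "same_bundle C \<dots>
      (lb_tensor C (lb_tensor C (lb_power C (lb_power C \<omega> N) m) (lb_power C (lb_product C Q D n) m))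
        (lb_power C (lb_pullback (emap X) M) (3 * N * m)))"
    by (intro same_bundle_tensor same_bundle_tensor_power same_bundle_power_power C
        transition_data_power transition_data_product T\<omega> TD Tf finQ)
  also have "same_bundle C \<dots>
      (lb_tensor C (lb_tensor C (lb_power C \<omega> (N * m)) (lb_product C P (\<lambda>i. D (\<phi> i)) n'))
        (lb_power C (lb_pullback (emap X) M) (3 * N * m)))"
    using same_bundle_power_power[OF C T\<omega>] prod
    by (intro same_bundle_tensor) (auto simp: same_bundle_def)
  finally have same: "same_bundle C
      (lb_power C (lb_tensor C (lb_tensor C (lb_power C \<omega> N) (lb_product C Q D n))
        (lb_power C (lb_pullback (emap X) M) (3 * N))) m)
      (lb_tensor C (lb_tensor C (lb_power C \<omega> (N * m)) (lb_product C P (\<lambda>i. D (\<phi> i)) n'))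
        (lb_power C (lb_pullback (emap X) M) (3 * (N * m))))"
    by (simp add: mult.assoc)
  have amp': "relatively_ample (curve X)
      (lb_tensor C (lb_tensor C (lb_power C \<omega> (N * m)) (lb_product C P (\<lambda>i. D (\<phi> i)) n'))
        (lb_power C (lb_pullback (emap X) M) (3 * (N * m))))"
    using relatively_ample_power[OF \<pi>[unfolded C_def] amp m] relatively_ample_cong[OF same[unfolded C_def]]
    unfolding C_def by blast

  let ?Y = "relabel_sections \<phi> S X"
  have Y: "curve ?Y = curve X" "emap ?Y = emap X" unfolding relabel_sections_def by simp_all
  have D': "section_divisor_bundle (sect ?Y i) (D (\<phi> i))" if "i \<in> P" for i
    using that D[of "\<phi> i"] PQ unfolding relabel_sections_def P_def by auto
  show ?thesis
    unfolding stable_map_def Let_def Y P_def[symmetric] C_def[symmetric]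
    using prestable_map_relabel[OF W pre] M N m n' \<omega> D' amp'
    by (intro conjI exI[of _ M] exI[of _ "N * m"] exI[of _ n'] exI[of _ \<omega>] exI[of _ "\<lambda>i. D (\<phi> i)"]) auto
qed

lemma stack_morphism_relabel:
  assumes W: "fibre_sum_weights \<phi> S A T B"
  shows "stack_morphism
    (Mbar k v g T B \<beta> :: ('j, 't, 'a, 'c, 'b, 'v, 'r, 'k) moduli)
    (Mbar k v g S A \<beta> :: ('i, 't, 'a, 'c, 'b, 'v, 'r, 'k) moduli)
    (relabel_sections \<phi> S) (\<lambda>h. h)"
proof -
  have "\<phi> i \<in> T" if "i \<in> S" for i
    using W that unfolding fibre_sum_weights_def by auto
  then show ?thesis
    using stable_map_relabel[OF W]
    unfolding stack_morphism_def Mbar_def by (auto simp: relabel_sections_def)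
qed

theorem proposition2p4:
  fixes k :: "'k ring"
    and v :: "('v, 'r, 'k spec_pt, 'k spec_sec) rmor"
    and g :: nat
    and S S' S'' :: "'i set"
    and A :: "'i \<Rightarrow> rat"
    and \<beta> :: "('v, 'r) line_bundle \<Rightarrow> int"
  assumes "Ring.field k"
    and "projective_variety k v"
    and "admissible k v g S A \<beta>"
    and "S' \<union> S'' = S" and "S' \<inter> S'' = {}"
    and "(\<Sum>i\<in>S''. A i) \<le> 1"
  shows "stack_morphism
    (Mbar k v g (starred_labels S') (starred_weights A (\<Sum>i\<in>S''. A i)) \<beta>
       :: ('i option, 't, 'a, 'c, 'b, 'v, 'r, 'k) moduli)
    (Mbar k v g S A \<beta> :: ('i, 't, 'a, 'c, 'b, 'v, 'r, 'k) moduli)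
    (duplicate_section S' S'') (\<lambda>h. h)"
proof -
  define \<phi> where "\<phi> = (\<lambda>i. if i \<in> S'' then None else Some i)"
  have S: "finite S" "\<And>i. i \<in> S \<Longrightarrow> 0 \<le> A i"
    using assms(3)[unfolded admissible_def, THEN conjunct1] unfolding weight_data_def by auto
  have "starred_weights A (\<Sum>i\<in>S''. A i) j = (\<Sum>i | i \<in> S \<and> \<phi> i = j. A i)"
    if "j \<in> starred_labels S'" for j
  proof (cases j)
    case None
    then have "{i. i \<in> S \<and> \<phi> i = j} = S''"
      using assms(4) unfolding \<phi>_def by auto
    with None show ?thesis unfolding starred_weights_def by simp
  next
    case (Some i)
    then have "{i. i \<in> S \<and> \<phi> i = j} = {i}"
      using that assms(4,5) unfolding \<phi>_def starred_labels_def by auto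
    with Some show ?thesis unfolding starred_weights_def by simp
  qed
  then have "fibre_sum_weights \<phi> S A (starred_labels S') (starred_weights A (\<Sum>i\<in>S''. A i))"
    unfolding fibre_sum_weights_def using S assms(4) by (auto simp: starred_labels_def \<phi>_def)
  moreover have "duplicate_section S' S'' = relabel_sections \<phi> S"
    using assms(4) unfolding duplicate_section_def relabel_sections_def \<phi>_def
    by (auto simp: fun_eq_iff restrict_def)
  ultimately show ?thesis
    using stack_morphism_relabel by metis
qed

end
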